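(* Let $[M_1,M_2,M_3]$ and $[E_1,E_2,E_3]$ be admissible data of $2\times2$ matrices, and let $\varkappa_1\ge\varkappa_2$ be the indices of the systems of standard form with these data and with singularities $a_1,a_2,a_3$. Assume that $[M_1,M_2,M_3]$ is irreducible, or that $[M_1,M_2,M_3]$ possesses exactly one non-trivial invariant subspace and $n_1<n_2$ holds. (a) If $\varkappa$ is odd, then $\varkappa_1=(\varkappa+1)/2$ and $\varkappa_2=(\varkappa-1)/2$. (b) If $\varkappa$ is even, then $\varkappa_1=\varkappa_2=\varkappa/2$.
   Context: Here $m=3$, $n=2$ in the following definitions. $\dot{\mathbb C}=\mathbb C\cup\{\infty\}$; $G\mathbb C^{n\times n}$ is the group of invertible complex $n\times n$ matrices; for single matrices $M\sim M'$ means similarity. The distinct points $a_1,\dots,a_m\in\mathbb C$ lie in this order on a fixed smooth (simple) closed positively oriented curve $\Gamma\subset\mathbb C$ (indices cyclic). Let $S=\dot{\mathbb C}\setminus\{a_1,\dots,a_m\}$, $\rho:\tilde S\to S$ its universal covering, write $z=\rho(\tilde z)$ for $\tilde z\in\tilde S$, and $\tilde S^*=\tilde S\setminus\rho^{-1}(\infty)$. For small $\delta>0$, $D_a=\{0<|z-a|<\delta\}$ ($a\in\mathbb C$), $D_\infty=\{|z|>1/\delta\}$, $\tilde D_a$ is the universal covering of $D_a$, and $(\tilde z-a)^E=\exp(E\ln(\tilde z-a))$ on $\tilde D_a$. Fix $\tilde z_0\in\tilde S$ with $\rho(\tilde z_0)$ inside $\Gamma$; for each $k$ let $\tilde z_k$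 be the endpoint of a simple path in $\tilde S$ starting at $\tilde z_0$ whose projection is a closed curve based at $\rho(\tilde z_0)$ meeting $\Gamma$ exactly twice, first on the subarc joining $a_{k-1}$ and $a_k$, then on the subarc joining $a_k$ and $a_{k+1}$ (so it goes once around $a_k$ in the positive direction), and let $\sigma_k$ be the deck transformation of $\tilde S$ with $\sigma_k(\tilde z_0)=\tilde z_k$. For a solution $Y:\tilde S^*\to G\mathbb C^{n\times n}$ of a linear system $Y'(\tilde z)=A(z)Y(\tilde z)$, the matrices $\chi(\sigma)$ are defined by $Y(\tilde z)=Y(\sigma(\tilde z))\chi(\sigma)$. Two $m$-tuples of matrices are equivalent if they are simultaneously similar; $[\cdot]_\sim$ is the equivalence class. The monodromy of the system is $[\chi(\sigma_1),\dots,\chi(\sigma_m)]_\sim$. A matrix is non-resonant if no two of its eigenvalues differ by a nonzero integer. Tuples $[M_1,\dots,M_m]$, $[E_1,\dots,E_m]$ of $n\times n$ matrices are admissible data if $M_1\cdots M_m=I$, $M_k\sim\exp(-2\pi iE_k)$ for each $k$, and all $E_k$ are non-resonant. The system $Y'(\tilde z)=A(z)Y(\tilde z)$ is of standard form with respect to these admissible data, with singularities $a_1,\dots,a_m$ and indices $\varkappa_1\ge\dots\ge\varkappa_n$ (integers) if: (i) it has singularities only at $a_1,\dots,a_m$ and at infinity (i.e. $A$ is analytic on $\mathbb C\setminus\{a_1,\dots,a_m\}$), the singularity at infinity being apparent (solutions have no branching there); (ii) its monodromy is $[M_1,\dots,M_m]_\sim$; (iii) for each $k$ the solutions on $\tilde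 D_{a_k}$ can be written $Y(\tilde z)=Z_k(z)(\tilde z-a_k)^{E_k}C$ with $Z_k:D_{a_k}\cup\{a_k\}\to G\mathbb C^{n\times n}$ analytic and $C\in G\mathbb C^{n\times n}$; (iv) the solutions on $D_\infty$ can be written $Y(z)=\mathrm{diag}(z^{\varkappa_1},\dots,z^{\varkappa_n})Z_\infty(z)C$ with $Z_\infty:D_\infty\cup\{\infty\}\to G\mathbb C^{n\times n}$ analytic and $C\in G\mathbb C^{n\times n}$. For given admissible data and singularities such a system exists and its indices are uniquely determined by the data and the singularities. Reducibility of $2\times2$ data. Put $\varkappa=\mathrm{trace}\,E_1+\dots+\mathrm{trace}\,E_m$. Invariant subspaces of $[M_1,\dots,M_m]$ are common invariant subspaces of all $M_k$; non-trivial means different from $\{0\}$ and $\mathbb C^2$; irreducible means that there is no non-trivial one. If $[M_1,\dots,M_m]$ has exactly one non-trivial invariant subspace, it is equivalent to a tuple of upper triangular matrices $\begin{pmatrix}\mu_k^{(1)}&\alpha_k\\0&\mu_k^{(2)}\end{pmatrix}$, $k=1,\dots,m$; here $\mu_k^{(1)}$ is the eigenvalue of $M_k$ on the invariant subspace and $\mu_k^{(2)}$ the other one, so these are unique. Let $\varepsilon_k^{(1)},\varepsilon_k^{(2)}$ be the eigenvalues of $E_k$ numbered such that $\mu_k^{(j)}=\exp(-2\pi i\varepsilon_k^{(j)})$ and define the integers $n_j=\varepsilon_1^{(j)}+\dots+\varepsilon_m^{(j)}$, $j=1,2$. *)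

theory Defs
  imports "HOL-Complex_Analysis.Complex_Analysis"
begin

section \<open>Complex matrices\<close>

definition similar :: "complex^'n^'n \<Rightarrow> complex^'n^'n \<Rightarrow> bool" where
  "similar A B \<longleftrightarrow> (\<exists>C. invertible C \<and> B = matrix_inv C ** A ** C)"

definition similarity_class :: "('k \<Rightarrow> complex^'n^'n) \<Rightarrow> ('k \<Rightarrow> complex^'n^'n) set" where
  "similarity_class M = {N. \<exists>C. invertible C \<and> (\<forall>k. N k = matrix_inv C ** M k ** C)}"

text \<open>The product on \<^typ>\<open>complex^'n^'n\<close> is not registered as a normed algebra, so \<^const>\<open>exp\<close>
  does not apply to matrices. A scalar multiple \<open>c E\<close> is written \<open>mat c ** E\<close>.\<close>

definition mexp :: "complex^'n^'n \<Rightarrow> complex^'n^'n" where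
  "mexp E = (\<Sum>k. (((**) E ^^ k) (mat 1)) /\<^sub>R fact k)"

definition eigenvalues :: "complex^'n^'n \<Rightarrow> complex set" where
  "eigenvalues E = {l. \<exists>v. v \<noteq> 0 \<and> E *v v = l *s v}"

definition non_resonant :: "complex^'n^'n \<Rightarrow> bool" where
  "non_resonant E \<longleftrightarrow>
     (\<forall>l\<in>eigenvalues E. \<forall>l'\<in>eigenvalues E. \<forall>d::int. d \<noteq> 0 \<longrightarrow> l - l' \<noteq> of_int d)"

text \<open>Triples are indexed by the type \<^typ>\<open>3\<close>, whose arithmetic is modulo 3 (so \<open>3 = 0\<close>);
  this makes the index \<open>k\<close> cyclic.\<close>

definition admissible_data :: "(3 \<Rightarrow> complex^2^2) \<Rightarrow> (3 \<Rightarrow> complex^2^2) \<Rightarrow> bool" where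
  "admissible_data M E \<longleftrightarrow>
     M 1 ** M 2 ** M 3 = mat 1 \<and>
     (\<forall>k. similar (M k) (mexp (mat (- 2 * of_real pi * \<i>) ** E k))) \<and>
     (\<forall>k. non_resonant (E k))"


section \<open>Reducibility\<close>

definition nontrivial_invariant_subspace :: "('k \<Rightarrow> complex^'n^'n) \<Rightarrow> (complex^'n) set \<Rightarrow> bool" where
  "nontrivial_invariant_subspace M U \<longleftrightarrow>
     vec.subspace U \<and> (\<forall>k. \<forall>v\<in>U. M k *v v \<in> U) \<and> U \<noteq> {0} \<and> U \<noteq> UNIV"

definition irreducible_tuple :: "('k \<Rightarrow> complex^'n^'n) \<Rightarrow> bool" where
  "irreducible_tuple M \<longleftrightarrow> \<not> (\<exists>U. nontrivial_invariant_subspace M U)"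

text \<open>\<open>N\<close> is an upper triangular form of \<open>M\<close>, with \<open>\<mu>\<^sub>k\<^sup>(\<^sup>j\<^sup>) = N k $ j $ j\<close>, and
  \<open>\<epsilon> k j\<close> is \<open>\<epsilon>\<^sub>k\<^sup>(\<^sup>j\<^sup>)\<close>. For \<open>2 \<times> 2\<close> matrices
  the equality of sets of eigenvalues already accounts for multiplicities.
  If \<open>M\<close> has exactly one non-trivial invariant subspace, then \<open>n\<close> is determined by
  \<open>M\<close> and \<open>E\<close>.\<close>

definition exponent_sums ::
    "(3 \<Rightarrow> complex^2^2) \<Rightarrow> (3 \<Rightarrow> complex^2^2) \<Rightarrow> (2 \<Rightarrow> int) \<Rightarrow> bool" where
  "exponent_sums M E n \<longleftrightarrow>
     (\<exists>N \<epsilon>. N \<in> similarity_class M \<and> (\<forall>k. N k $ 2 $ 1 = 0) \<and>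
        (\<forall>k. eigenvalues (E k) = {\<epsilon> k 1, \<epsilon> k 2}) \<and>
        (\<forall>k j. N k $ j $ j = exp (- 2 * of_real pi * \<i> * \<epsilon> k j)) \<and>
        (\<forall>j. of_int (n j) = (\<Sum>k\<in>UNIV. \<epsilon> k j)))"


section \<open>The Riemann sphere and its coverings\<close>

text \<open>The topology is that of the one-point compactification of the plane.\<close>

datatype riemann_sphere = Fin (fin_part: complex) | Infty

instantiation riemann_sphere :: topological_space
begin

definition open_riemann_sphere :: "riemann_sphere set \<Rightarrow> bool" where
  "open_riemann_sphere U \<longleftrightarrow> open (Fin -` U) \<and> (Infty \<in> U \<longrightarrow> compact (- (Fin -` U)))"

instance
proof
  show "open (UNIV :: riemann_sphere set)"
    by (simp add: open_riemann_sphere_def)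
next
  fix S T :: "riemann_sphere set"
  assume "open S" "open T"
  then show "open (S \<inter> T)"
    by (auto simp: open_riemann_sphere_def compact_Un Compl_Int)
next
  fix K :: "riemann_sphere set set"
  assume K: "\<forall>S\<in>K. open S"
  have op: "open (Fin -` \<Union>K)"
    using K by (auto simp: vimage_Union open_riemann_sphere_def)
  have "compact (- (Fin -` \<Union>K))" if inf: "Infty \<in> \<Union>K"
  proof -
    obtain S where S: "S \<in> K" "Infty \<in> S" using inf by blast
    then have "compact (- (Fin -` S))" using K by (auto simp: open_riemann_sphere_def)
    moreover have "- (Fin -` \<Union>K) = - (Fin -` S) \<inter> - (Fin -` \<Union>K)" using S by auto
    ultimately show ?thesis using op by (metis closed_Compl compact_Int_closed)
  qed
  then show "open (\<Union>K)" using op by (simp add: open_riemann_sphere_def)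
qed

end

definition universal_covering ::
    "'b::topological_space set \<Rightarrow> ('b \<Rightarrow> 'c::topological_space) \<Rightarrow> 'c set \<Rightarrow> bool" where
  "universal_covering X \<rho> S \<longleftrightarrow> covering_space X \<rho> S \<and> simply_connected X"

definition deck_transformation ::
    "'b::topological_space set \<Rightarrow> ('b \<Rightarrow> 'c) \<Rightarrow> ('b \<Rightarrow> 'b) \<Rightarrow> bool" where
  "deck_transformation X \<rho> s \<longleftrightarrow>
     (\<exists>s'. homeomorphism X X s s') \<and> (\<forall>x\<in>X. \<rho> (s x) = \<rho> x)"


section \<open>The curve through the singularities and the loops around them\<close>

text \<open>The curve is parametrized by a 1-periodic regular \<open>C\<^sup>1\<close> function \<open>g\<close> which is injective
  on a period; the point \<open>a k\<close> is \<open>g (t k)\<close>.\<close>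

definition curve_through ::
    "(real \<Rightarrow> complex) \<Rightarrow> (3 \<Rightarrow> real) \<Rightarrow> (3 \<Rightarrow> complex) \<Rightarrow> bool" where
  "curve_through g t a \<longleftrightarrow>
     (\<forall>s. g (s + 1) = g s) \<and> g C1_differentiable_on UNIV \<and>
     (\<forall>s. vector_derivative g (at s) \<noteq> 0) \<and> simple_path g \<and>
     (\<forall>z\<in>inside (path_image g). winding_number g z = 1) \<and>
     t 1 < t 2 \<and> t 2 < t 3 \<and> t 3 < t 1 + 1 \<and> (\<forall>k. a k = g (t k))"

text \<open>The open subarc joining \<open>a k\<close> and \<open>a (k + 1)\<close>.\<close>

definition subarc :: "(real \<Rightarrow> complex) \<Rightarrow> (3 \<Rightarrow> real) \<Rightarrow> 3 \<Rightarrow> complex set" where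
  "subarc g t k = g ` {t k <..< (if k = 3 then t 1 + 1 else t (k + 1))}"

text \<open>\<open>p\<close> is a simple path in the covering whose projection is closed and meets the curve exactly
  twice, leaving the interior between \<open>a (k - 1)\<close> and \<open>a k\<close> and returning between \<open>a k\<close> and
  \<open>a (k + 1)\<close>. The condition on \<open>{s1<..<s2}\<close> makes explicit that the projection crosses the curve
  at these two points and does not merely touch it; the part outside the curve may pass through
  infinity.\<close>

definition loop_around ::
    "'b::topological_space set \<Rightarrow> ('b \<Rightarrow> riemann_sphere) \<Rightarrow> (real \<Rightarrow> complex) \<Rightarrow> (3 \<Rightarrow> real)
      \<Rightarrow> 3 \<Rightarrow> (real \<Rightarrow> 'b) \<Rightarrow> bool" where
  "loop_around X \<rho> g t k p \<longleftrightarrow>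
     arc p \<and> path_image p \<subseteq> X \<and> \<rho> (pathfinish p) = \<rho> (pathstart p) \<and>
     (\<exists>s1 s2. s1 < s2 \<and>
        {s \<in> {0..1}. \<rho> (p s) \<in> Fin ` path_image g} = {s1, s2} \<and>
        \<rho> (p s1) \<in> Fin ` subarc g t (k - 1) \<and>
        \<rho> (p s2) \<in> Fin ` subarc g t k \<and>
        (\<forall>s\<in>{s1<..<s2}. \<rho> (p s) \<notin> Fin ` inside (path_image g)))"

definition basic_deck_transformations ::
    "'b::topological_space set \<Rightarrow> ('b \<Rightarrow> riemann_sphere) \<Rightarrow> (real \<Rightarrow> complex) \<Rightarrow> (3 \<Rightarrow> real)
      \<Rightarrow> 'b \<Rightarrow> (3 \<Rightarrow> 'b \<Rightarrow> 'b) \<Rightarrow> bool" where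
  "basic_deck_transformations X \<rho> g t z0 \<sigma> \<longleftrightarrow>
     z0 \<in> X \<and> \<rho> z0 \<in> Fin ` inside (path_image g) \<and>
     (\<forall>k. deck_transformation X \<rho> (\<sigma> k) \<and>
        (\<exists>p. loop_around X \<rho> g t k p \<and> pathstart p = z0 \<and> pathfinish p = \<sigma> k z0))"


section \<open>Linear systems and their monodromy\<close>

text \<open>Solutions with values in the invertible matrices of \<open>Y' = A(z) Y\<close> on a Riemann surface \<open>X\<close>
  spread over the plane: \<open>z = \<pi> x\<close> is a local coordinate on \<open>X\<close>, and \<open>Y'\<close> is the derivative with
  respect to this coordinate.\<close>

definition solution ::
    "'b::topological_space set \<Rightarrow> ('b \<Rightarrow> complex) \<Rightarrow> (complex \<Rightarrow> complex^'n^'n)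
      \<Rightarrow> ('b \<Rightarrow> complex^'n^'n) \<Rightarrow> bool" where
  "solution X \<pi> A Y \<longleftrightarrow>
     (\<forall>x\<in>X. invertible (Y x) \<and>
        ((\<lambda>y. mat (1 / (\<pi> y - \<pi> x)) ** (Y y - Y x)) \<longlongrightarrow> A (\<pi> x) ** Y x) (at x within X))"

text \<open>The set of all \<open>(N 1, N 2, N 3)\<close>, \<open>N k = \<chi>(\<sigma> k)\<close>, for solutions on the covering with the
  fibre over infinity removed. It is empty if there is no such solution, that is, if solutions
  branch at infinity.\<close>

definition monodromy ::
    "'b::topological_space set \<Rightarrow> ('b \<Rightarrow> riemann_sphere) \<Rightarrow> ('k \<Rightarrow> 'b \<Rightarrow> 'b)
      \<Rightarrow> (complex \<Rightarrow> complex^'n^'n) \<Rightarrow> ('k \<Rightarrow> complex^'n^'n) set" where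
  "monodromy X \<rho> \<sigma> A =
     {N. \<exists>Y. solution (X - \<rho> -` {Infty}) (\<lambda>x. fin_part (\<rho> x)) A Y \<and>
             (\<forall>k. \<forall>x\<in>X - \<rho> -` {Infty}. Y x = Y (\<sigma> k x) ** N k)}"

definition analytic_invertible :: "complex set \<Rightarrow> (complex \<Rightarrow> complex^'n^'n) \<Rightarrow> bool" where
  "analytic_invertible D Z \<longleftrightarrow>
     (\<forall>i j. (\<lambda>z. Z z $ i $ j) holomorphic_on D) \<and> (\<forall>z\<in>D. invertible (Z z))"

text \<open>The universal covering of the punctured disc of radius \<open>\<delta>\<close> around \<open>a\<close> is the half plane
  \<open>Re w < ln \<delta>\<close> with projection \<open>w \<mapsto> a + exp w\<close>, so that \<open>w\<close> is the logarithm of \<open>z - a\<close>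
  and \<open>(z - a)\<^sup>E\<close> is \<open>exp (w E)\<close>.\<close>

definition local_form_at ::
    "complex \<Rightarrow> complex^'n^'n \<Rightarrow> (complex \<Rightarrow> complex^'n^'n) \<Rightarrow> bool" where
  "local_form_at a E A \<longleftrightarrow>
     (\<forall>\<^sub>F \<delta> in at_right 0. \<exists>Z. analytic_invertible (ball a \<delta>) Z \<and>
        (\<forall>Y. solution {w. Re w < ln \<delta>} (\<lambda>w. a + exp w) A Y \<longleftrightarrow>
           (\<exists>C. invertible C \<and>
              (\<forall>w. Re w < ln \<delta> \<longrightarrow> Y w = Z (a + exp w) ** mexp (mat w ** E) ** C))))"

text \<open>Here \<open>Z u\<close> stands for the value of the analytic factor at \<open>z = 1 / u\<close>; thus \<open>Z 0\<close> is its
  value at infinity.\<close>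

definition local_form_infinity ::
    "('n \<Rightarrow> int) \<Rightarrow> (complex \<Rightarrow> complex^'n^'n) \<Rightarrow> bool" where
  "local_form_infinity \<kappa> A \<longleftrightarrow>
     (\<forall>\<^sub>F \<delta> in at_right 0. \<exists>Z. analytic_invertible (ball 0 \<delta>) Z \<and>
        (\<forall>Y. solution {z. cmod z > 1 / \<delta>} (\<lambda>z. z) A Y \<longleftrightarrow>
           (\<exists>C. invertible C \<and>
              (\<forall>z. cmod z > 1 / \<delta> \<longrightarrow>
                 Y z = (\<chi> i j. if i = j then z powi \<kappa> i else 0) ** Z (1 / z) ** C))))"

definition standard_form ::
    "'b::topological_space set \<Rightarrow> ('b \<Rightarrow> riemann_sphere) \<Rightarrow> (3 \<Rightarrow> 'b \<Rightarrow> 'b) \<Rightarrow> (3 \<Rightarrow> complex)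
      \<Rightarrow> (3 \<Rightarrow> complex^2^2) \<Rightarrow> (3 \<Rightarrow> complex^2^2) \<Rightarrow> (2 \<Rightarrow> int)
      \<Rightarrow> (complex \<Rightarrow> complex^2^2) \<Rightarrow> bool" where
  "standard_form X \<rho> \<sigma> a M E \<kappa> A \<longleftrightarrow>
     \<kappa> 1 \<ge> \<kappa> 2 \<and>
     (\<forall>i j. (\<lambda>z. A z $ i $ j) holomorphic_on (- range a)) \<and>
     monodromy X \<rho> \<sigma> A = similarity_class M \<and>
     (\<forall>k. local_form_at (a k) (E k) A) \<and>
     local_form_infinity \<kappa> A"

end

theory Submission
  imports Defs
begin

text \<open>
  If \<open>\<kappa>\<^sub>1 - \<kappa>\<^sub>2 \<ge> 2\<close>, the behaviour at infinity makes \<open>A\<^sub>2\<^sub>1 (z - a\<^sub>1) (z - a\<^sub>2) (z - a\<^sub>3)\<close> an entire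
  function vanishing at infinity, so \<open>A\<close> is upper triangular, with diagonal entries
  \<open>\<Sum>\<^sub>k \<epsilon>\<^sub>k / (z - a\<^sub>k)\<close> where \<open>\<epsilon>\<^sub>k\<close> is an eigenvalue of \<open>E\<^sub>k\<close>, and the residues in row \<open>i\<close> add up to
  \<open>\<kappa>\<^sub>i\<close>. The constant vectors \<open>v\<close> for which the second component of \<open>Y v\<close> vanishes then form a
  non-trivial invariant subspace. The first component \<open>\<psi>\<close> of \<open>Y v\<close> solves the scalar equation
  \<open>\<psi>' = A\<^sub>1\<^sub>1 \<psi>\<close>, so continuing it once around \<open>a\<^sub>k\<close> multiplies it by \<open>exp (2\<pi>i \<epsilon>\<^sub>k)\<close>; by non-resonance
  \<open>\<epsilon>\<^sub>k\<close> is the exponent belonging to this subspace, whence \<open>n\<^sub>1 = \<kappa>\<^sub>1 > \<kappa>\<^sub>2 = n\<^sub>2\<close>, contradicting \<open>n\<^sub>1 < n\<^sub>2\<close>.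
  Therefore \<open>\<kappa>\<^sub>1 - \<kappa>\<^sub>2\<close> is 0 or 1, and \<open>\<kappa>\<^sub>1 + \<kappa>\<^sub>2 = \<kappa>\<close> gives the indices.

  The multiplier is computed without homotopies. The integral \<open>I\<^sub>j(z)\<close> of \<open>1 / (w - z)\<close> over the arc from
  \<open>a\<^sub>j\<close> to \<open>a\<^sub>j\<^sub>+\<^sub>1\<close> is a logarithm of \<open>(a\<^sub>j\<^sub>+\<^sub>1 - z) / (a\<^sub>j - z)\<close> off that arc, and \<open>I\<^sub>1 + I\<^sub>2 + I\<^sub>3\<close> is
  \<open>2\<pi>i\<close> times the winding number of the curve. Up to a point outside the curve, the loop around
  \<open>a\<^sub>k\<close> avoids the arcs of \<open>I\<^sub>k\<close> and \<open>I\<^sub>k\<^sub>+\<^sub>1\<close>, and from there on those of \<open>I\<^sub>k\<^sub>-\<^sub>1\<close> and \<open>I\<^sub>k\<^sub>+\<^sub>1\<close>; the two resulting formulas for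
  \<open>\<psi>\<close> agree outside the curve and differ by the factor \<open>exp (2\<pi>i \<epsilon>\<^sub>k)\<close> inside.
\<close>

no_notation fps_nth (infixl \<open>$\<close> 75)


section \<open>Local solutions\<close>

lemma mat_mult_component: "(mat c ** (B::complex^'n^'m)) $ i $ j = c * B $ i $ j"
  by (simp add: matrix_matrix_mult_def mat_def if_distrib if_distribR sum.delta cong: if_cong)

lemma matrix_mult_component: "((B::complex^'n^'m) ** (C::complex^'k^'n)) $ i $ j = (\<Sum>l\<in>UNIV. B $ i $ l * C $ l $ j)"
  by (simp add: matrix_matrix_mult_def)

lemma invertible_one: "invertible (mat 1 :: complex^'n^'n)"
  unfolding invertible_def by (rule exI[of _ "mat 1"]) simp

lemma matrix_add_mult_distrib: "(A + B) ** C = A ** C + B ** (C::complex^'k^'n)"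
  by (simp add: vec_eq_iff matrix_mult_component distrib_right sum.distrib)

text \<open>Take for \<open>B\<close> the sum of the moduli of all entries: it dominates every
  absolute row sum, so one more factor \<open>E\<close> enlarges the entries at most by
  \<open>B\<close>. The bound yields entrywise convergence of the exponential series.\<close>

lemma matrix_power_bound:
  fixes E :: "complex^'n^'n"
  obtains B where "\<And>k i j. norm ((((**) E ^^ k) (mat 1)) $ i $ j) \<le> B ^ k"
proof -
  define B where "B = (\<Sum>i\<in>UNIV. \<Sum>l\<in>UNIV. norm (E $ i $ l))"
  have row: "(\<Sum>l\<in>UNIV. norm (E $ i $ l)) \<le> B" for i
    unfolding B_def by (rule member_le_sum) (auto intro: sum_nonneg)
  have B: "B \<ge> 0"
    unfolding B_def by (intro sum_nonneg) auto
  have "norm ((((**) E ^^ k) (mat 1)) $ i $ j) \<le> B ^ k" for k i j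
  proof (induction k arbitrary: i)
    case 0
    then show ?case by (simp add: mat_def)
  next
    case (Suc k)
    have "norm ((((**) E ^^ Suc k) (mat 1)) $ i $ j)
        \<le> (\<Sum>l\<in>UNIV. norm (E $ i $ l) * norm ((((**) E ^^ k) (mat 1)) $ l $ j))"
      by (simp add: matrix_mult_component norm_sum flip: norm_mult)
    also have "\<dots> \<le> (\<Sum>l\<in>UNIV. norm (E $ i $ l) * B ^ k)"
      by (intro sum_mono mult_left_mono Suc) auto
    also have "\<dots> = (\<Sum>l\<in>UNIV. norm (E $ i $ l)) * B ^ k"
      by (simp add: sum_distrib_right)
    also have "\<dots> \<le> B * B ^ k"
      using row B by (intro mult_right_mono) auto
    finally show ?case by simp
  qed
  then show ?thesis using that by blast
qed

text \<open>Splitting off \<open>w ^ k\<close> turns each entry of the exponential into a scalar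
  power series in \<open>w\<close>, dominated by the exponential series of
  \<open>B * norm w\<close>. Termwise differentiation then applies.\<close>

lemma mexp_component_series:
  fixes E :: "complex^'n^'n"
  shows "(\<lambda>k. ((((**) E ^^ k) (mat 1)) $ i $ j / fact k) * w ^ k) sums (mexp (mat w ** E) $ i $ j)"
proof -
  define P where "P k = ((**) E ^^ k) (mat 1)" for k
  obtain B where B: "\<And>k i j. norm (P k $ i $ j) \<le> B ^ k"
    unfolding P_def using matrix_power_bound[of E] by metis
  have pow: "((**) (mat w ** E) ^^ k) (mat 1) $ i $ j = w ^ k * P k $ i $ j" for i j k
  proof (induction k arbitrary: i)
    case 0
    then show ?case by (simp add: P_def)
  next
    case (Suc k)
    have "((**) (mat w ** E) ^^ Suc k) (mat 1) $ i $ j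
        = w * (\<Sum>l\<in>UNIV. E $ i $ l * (((**) (mat w ** E) ^^ k) (mat 1) $ l $ j))"
      by (simp flip: matrix_mul_assoc add: mat_mult_component) (simp add: matrix_mult_component)
    also have "\<dots> = w ^ Suc k * P (Suc k) $ i $ j"
      by (simp add: Suc P_def matrix_mult_component sum_distrib_left mult_ac)
    finally show ?case .
  qed
  have comp: "((((**) (mat w ** E) ^^ k) (mat 1)) /\<^sub>R fact k) $ i $ j = (P k $ i $ j / fact k) * w ^ k"
    for i j k
    by (simp add: pow scaleR_conv_of_real[where 'a=complex] divide_inverse mult_ac)
  have summ: "summable (\<lambda>k. (P k $ i $ j / fact k) * w ^ k)" for i j
  proof (rule summable_comparison_test')
    show "summable (\<lambda>k. (B * norm w) ^ k /\<^sub>R fact k)"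
      by (rule summable_exp_generic)
    fix k :: nat
    show "norm (P k $ i $ j / fact k * w ^ k) \<le> (B * norm w) ^ k /\<^sub>R fact k"
      using mult_right_mono[OF B[of k i j], of "norm w ^ k / fact k"]
      by (simp add: norm_mult norm_divide norm_power power_mult_distrib divide_right_mono)
        (simp add: divide_inverse mult_ac)
  qed
  \<comment> \<open>The series in \<open>mexp\<close> has matrix terms; its value is identified
    through the limits of the entries.\<close>
  have "(\<lambda>k. (((**) (mat w ** E) ^^ k) (mat 1)) /\<^sub>R fact k)
      sums (\<chi> i j. \<Sum>k. (P k $ i $ j / fact k) * w ^ k)"
    unfolding sums_def
  proof (intro vec_tendstoI)
    fix i j
    show "(\<lambda>n. (\<Sum>k<n. (((**) (mat w ** E) ^^ k) (mat 1)) /\<^sub>R fact k) $ i $ j)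
      \<longlonglongrightarrow> (\<chi> i j. \<Sum>k. (P k $ i $ j / fact k) * w ^ k) $ i $ j"
      using summable_LIMSEQ[OF summ[of i j]] by (simp add: comp del: vector_scaleR_component)
  qed
  then have "mexp (mat w ** E) = (\<chi> i j. \<Sum>k. (P k $ i $ j / fact k) * w ^ k)"
    unfolding mexp_def by (rule sums_unique[symmetric])
  then show ?thesis
    using summable_sums[OF summ[of i j]] by (simp add: P_def)
qed

text \<open>Termwise differentiation shifts the coefficients, and the shifted coefficient matrix is
  \<open>E\<close> times the unshifted one.\<close>

lemma mexp_has_field_derivative:
  fixes E :: "complex^'n^'n"
  shows "((\<lambda>w. mexp (mat w ** E) $ i $ j) has_field_derivative (E ** mexp (mat w ** E)) $ i $ j) (at w)"
proof -
  define c where "c i k = (((**) E ^^ k) (mat 1)) $ i $ j / fact k" for i k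
  have ser: "(\<lambda>k. c i k * w ^ k) sums (mexp (mat w ** E) $ i $ j)" for i w
    unfolding c_def by (rule mexp_component_series)
  have fun_eq: "(\<lambda>w. \<Sum>k. c i k * w ^ k) = (\<lambda>w. mexp (mat w ** E) $ i $ j)"
    using sums_unique[OF ser] by auto
  have "((\<lambda>w. \<Sum>k. c i k * w ^ k) has_field_derivative (\<Sum>k. diffs (c i) k * w ^ k)) (at w)"
    by (intro termdiffs_strong_converges_everywhere sums_summable[OF ser])
  moreover have "diffs (c i) k * w ^ k = (\<Sum>l\<in>UNIV. E $ i $ l * (c l k * w ^ k))" for k
  proof -
    have "diffs (c i) k = of_nat (Suc k) * ((E ** ((**) E ^^ k) (mat 1)) $ i $ j / (of_nat (Suc k) * fact k))"
      by (simp only: diffs_def c_def funpow.simps o_apply fact_Suc)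
    also have "\<dots> = (E ** ((**) E ^^ k) (mat 1)) $ i $ j / fact k"
      by (simp del: of_nat_Suc)
    also have "\<dots> = (\<Sum>l\<in>UNIV. E $ i $ l * c l k)"
      unfolding matrix_mult_component c_def sum_divide_distrib by simp
    finally have "diffs (c i) k = (\<Sum>l\<in>UNIV. E $ i $ l * c l k)" .
    then show ?thesis
      by (simp add: sum_distrib_left mult_ac)
  qed
  moreover have "(\<lambda>k. \<Sum>l\<in>UNIV. E $ i $ l * (c l k * w ^ k))
      sums (\<Sum>l\<in>UNIV. E $ i $ l * mexp (mat w ** E) $ l $ j)"
    by (intro sums_sum sums_mult ser)
  ultimately show ?thesis
    by (simp add: fun_eq matrix_mult_component sums_iff)
qed

section \<open>Derivatives of solutions and differential equations for the local factors\<close>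

lemma solution_component:
  assumes "solution D \<pi> A Y" "x \<in> D"
  shows "((\<lambda>y. (Y y $ i $ j - Y x $ i $ j) / (\<pi> y - \<pi> x)) \<longlongrightarrow> (A (\<pi> x) ** Y x) $ i $ j) (at x within D)"
proof -
  have 1: "((\<lambda>y. mat (1 / (\<pi> y - \<pi> x)) ** (Y y - Y x)) \<longlongrightarrow> A (\<pi> x) ** Y x) (at x within D)"
    using assms unfolding solution_def by blast
  have "((\<lambda>y. (mat (1 / (\<pi> y - \<pi> x)) ** (Y y - Y x)) $ i $ j) \<longlongrightarrow> (A (\<pi> x) ** Y x) $ i $ j) (at x within D)"
    by (rule tendsto_vec_nth[OF tendsto_vec_nth[OF 1]])
  moreover have "(mat (1 / (\<pi> y - \<pi> x)) ** (Y y - Y x)) $ i $ j = (Y y $ i $ j - Y x $ i $ j) / (\<pi> y - \<pi> x)" for y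
    by (simp add: mat_mult_component)
  ultimately show ?thesis by simp
qed

text \<open>Chain rule: \<open>solution\<close> differentiates with respect to the coordinate
  \<open>\<pi>\<close>. Since \<open>d \<noteq> 0\<close>, the difference
  \<open>\<pi> y - \<pi> w\<close> does not vanish for \<open>y\<close> near \<open>w\<close> and
  can be cancelled between the two difference quotients.\<close>

lemma solution_has_field_derivative:
  assumes sol: "solution D \<pi> A Y" and D: "open D" "w \<in> D"
    and \<pi>: "(\<pi> has_field_derivative d) (at w)" "d \<noteq> 0"
  shows "((\<lambda>w. Y w $ i $ j) has_field_derivative d * (A (\<pi> w) ** Y w) $ i $ j) (at w)"
proof -
  have 1: "((\<lambda>y. (Y y $ i $ j - Y w $ i $ j) / (\<pi> y - \<pi> w)) \<longlongrightarrow> (A (\<pi> w) ** Y w) $ i $ j) (at w)"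
    using solution_component[OF sol D(2), of i j] unfolding at_within_open[OF D(2,1)] .
  have 2: "((\<lambda>y. (\<pi> y - \<pi> w) / (y - w)) \<longlongrightarrow> d) (at w)"
    using \<pi>(1) unfolding has_field_derivative_iff .
  have ev: "\<forall>\<^sub>F y in at w. (\<pi> y - \<pi> w) / (y - w) \<noteq> 0"
    using tendsto_imp_eventually_ne[OF 2 \<pi>(2)] .
  have "((\<lambda>y. (\<pi> y - \<pi> w) / (y - w) * ((Y y $ i $ j - Y w $ i $ j) / (\<pi> y - \<pi> w)))
      \<longlongrightarrow> d * (A (\<pi> w) ** Y w) $ i $ j) (at w)"
    by (intro tendsto_mult 1 2)
  moreover have "\<forall>\<^sub>F y in at w. (\<pi> y - \<pi> w) / (y - w) * ((Y y $ i $ j - Y w $ i $ j) / (\<pi> y - \<pi> w))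
      = (Y y $ i $ j - Y w $ i $ j) / (y - w)"
    using ev by (rule eventually_mono) simp
  ultimately show ?thesis
    unfolding has_field_derivative_iff by (rule Lim_transform_eventually)
qed

definition deriv_mat :: "(complex \<Rightarrow> complex^'n^'n) \<Rightarrow> complex \<Rightarrow> complex^'n^'n" where
  "deriv_mat Z z = (\<chi> i j. deriv (\<lambda>z. Z z $ i $ j) z)"

text \<open>Insert the solution \<open>Z (a + exp w) ** mexp (mat w ** E)\<close> into the system
  and cancel the exponential. Differentiation in \<open>w\<close> supplies the factor
  \<open>z - a\<close>, with which both sides stay finite as \<open>z\<close> tends to
  \<open>a\<close>.\<close>

lemma local_form_at_equation:
  assumes Z: "analytic_invertible (ball a \<delta>) Z" and \<delta>: "\<delta> > 0"
    and form: "\<And>Y. solution {w. Re w < ln \<delta>} (\<lambda>w. a + exp w) A Y \<longleftrightarrow>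
           (\<exists>C. invertible C \<and> (\<forall>w. Re w < ln \<delta> \<longrightarrow> Y w = Z (a + exp w) ** mexp (mat w ** E) ** C))"
    and z: "z \<in> ball a \<delta>" "z \<noteq> a"
  shows "mat (z - a) ** (A z ** Z z) = mat (z - a) ** deriv_mat Z z + Z z ** E"
proof -
  define Y where "Y w = Z (a + exp w) ** mexp (mat w ** E)" for w
  let ?D = "{w. Re w < ln \<delta>}"
  have sol: "solution ?D (\<lambda>w. a + exp w) A Y"
    unfolding form by (rule exI[of _ "mat 1"]) (simp add: Y_def invertible_one)
  have D: "open ?D"
    by (rule open_halfspace_Re_lt)
  \<comment> \<open>A preimage of \<open>z\<close> in the half plane covering the punctured
    disc.\<close>
  define w where "w = Ln (z - a)"
  have zw: "z = a + exp w" and wD: "w \<in> ?D"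
    using z \<delta> by (auto simp: w_def dist_norm norm_minus_commute)
  have d1: "((\<lambda>w. Y w $ i $ j) has_field_derivative exp w * (A z ** Y w) $ i $ j) (at w)" for i j
    unfolding zw by (rule solution_has_field_derivative[OF sol D wD]) (auto intro!: derivative_eq_intros)
  have dZ: "((\<lambda>w. Z (a + exp w) $ i $ l) has_field_derivative deriv_mat Z z $ i $ l * exp w) (at w)" for i l
  proof -
    have "((\<lambda>z. Z z $ i $ l) has_field_derivative deriv (\<lambda>z. Z z $ i $ l) z) (at z)"
      using Z holomorphic_derivI[OF _ open_ball z(1), of "\<lambda>z. Z z $ i $ l"]
      by (simp add: analytic_invertible_def)
    moreover have "((\<lambda>w. a + exp w) has_field_derivative exp w) (at w)"
      by (auto intro!: derivative_eq_intros)
    ultimately show ?thesis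
      using DERIV_chain2[of "\<lambda>z. Z z $ i $ l" _ "\<lambda>w. a + exp w" w "exp w"]
      by (simp add: zw deriv_mat_def)
  qed
  have d2: "((\<lambda>w. Y w $ i $ j) has_field_derivative
      (mat (exp w) ** deriv_mat Z z ** mexp (mat w ** E) + Z z ** E ** mexp (mat w ** E)) $ i $ j) (at w)" for i j
  proof -
    have "((\<lambda>w. \<Sum>l\<in>UNIV. Z (a + exp w) $ i $ l * mexp (mat w ** E) $ l $ j) has_field_derivative
      (\<Sum>l\<in>UNIV. (deriv_mat Z z $ i $ l * exp w) * mexp (mat w ** E) $ l $ j
        + (E ** mexp (mat w ** E)) $ l $ j * Z z $ i $ l)) (at w)"
      using DERIV_mult[OF dZ mexp_has_field_derivative] by (intro DERIV_sum) (simp flip: zw)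
    moreover have "(\<Sum>l\<in>UNIV. (deriv_mat Z z $ i $ l * exp w) * mexp (mat w ** E) $ l $ j
        + (E ** mexp (mat w ** E)) $ l $ j * Z z $ i $ l)
      = (mat (exp w) ** deriv_mat Z z ** mexp (mat w ** E) + Z z ** E ** mexp (mat w ** E)) $ i $ j"
    proof -
      have "(mat (exp w) ** deriv_mat Z z ** mexp (mat w ** E)) $ i $ j
          = (\<Sum>l\<in>UNIV. (deriv_mat Z z $ i $ l * exp w) * mexp (mat w ** E) $ l $ j)"
        by (simp add: matrix_mult_component[of "mat (exp w) ** _"] mat_mult_component mult_ac)
      moreover have "(Z z ** E ** mexp (mat w ** E)) $ i $ j
          = (\<Sum>l\<in>UNIV. (E ** mexp (mat w ** E)) $ l $ j * Z z $ i $ l)"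
        unfolding matrix_mul_assoc[symmetric]
        by (subst matrix_mult_component) (simp add: mult_ac)
      ultimately show ?thesis by (simp add: sum.distrib)
    qed
    ultimately show ?thesis by (simp add: Y_def matrix_mult_component[of "Z _"])
  qed
  have eq: "mat (exp w) ** (A z ** Y w)
      = mat (exp w) ** deriv_mat Z z ** mexp (mat w ** E) + Z z ** E ** mexp (mat w ** E)"
    unfolding vec_eq_iff
  proof (intro allI)
    fix i j
    show "(mat (exp w) ** (A z ** Y w)) $ i $ j
      = (mat (exp w) ** deriv_mat Z z ** mexp (mat w ** E) + Z z ** E ** mexp (mat w ** E)) $ i $ j"
      using DERIV_unique[OF d1 d2] by (simp add: mat_mult_component)
  qed
  have "invertible (Y w)"
    using sol wD by (auto simp: solution_def)
  then obtain B where B: "Y w ** B = mat 1"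
    by (auto simp: invertible_def)
  have Zi: "invertible (Z z)"
    using Z z by (auto simp: analytic_invertible_def)
  have "Z z ** (mexp (mat w ** E) ** B) = mat 1"
    using B by (simp add: Y_def zw matrix_mul_assoc)
  then have "mexp (mat w ** E) ** B ** Z z = mat 1"
    by (metis matrix_left_right_inverse)
  then have m: "mexp (mat w ** E) ** (B ** Z z) = mat 1"
    by (simp add: matrix_mul_assoc)
  have "mat (exp w) ** (A z ** Z z) ** (mexp (mat w ** E) ** (B ** Z z))
      = (mat (exp w) ** (A z ** Y w)) ** (B ** Z z)"
    by (simp add: Y_def matrix_mul_assoc zw)
  also have "\<dots> = mat (exp w) ** deriv_mat Z z ** (mexp (mat w ** E) ** (B ** Z z))
      + Z z ** E ** (mexp (mat w ** E) ** (B ** Z z))"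
    unfolding eq by (simp add: matrix_add_mult_distrib matrix_mul_assoc)
  finally show ?thesis
    unfolding m by (simp add: zw)
qed

text \<open>Insert the diagonal powers times \<open>Z (1 / z)\<close> into the system and divide row
  \<open>i\<close> by \<open>z powi \<kappa> i\<close>. The diagonal factor produces the exponents
  \<open>\<kappa> l - \<kappa> i\<close>, the derivative of \<open>1 / z\<close> the factor
  \<open>- 1 / z\<^sup>2\<close>.\<close>

lemma local_form_infinity_equation:
  assumes Z: "analytic_invertible (ball 0 \<delta>) Z" and \<delta>: "\<delta> > 0"
    and form: "\<And>Y. solution {z. cmod z > 1 / \<delta>} (\<lambda>z. z) A Y \<longleftrightarrow>
           (\<exists>C. invertible C \<and> (\<forall>z. cmod z > 1 / \<delta> \<longrightarrow>
                 Y z = (\<chi> i j. if i = j then z powi \<kappa> i else 0) ** Z (1 / z) ** C))"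
    and z: "cmod z > 1 / \<delta>"
  shows "(\<Sum>l\<in>UNIV. A z $ i $ l * z powi (\<kappa> l - \<kappa> i) * Z (1 / z) $ l $ j)
    = of_int (\<kappa> i) / z * Z (1 / z) $ i $ j - deriv_mat Z (1 / z) $ i $ j / z\<^sup>2"
proof -
  define Y where "Y z = (\<chi> i j. if i = j then z powi \<kappa> i else 0) ** Z (1 / z)" for z
  let ?D = "{z. cmod z > 1 / \<delta>}"
  have sol: "solution ?D (\<lambda>z. z) A Y"
    unfolding form by (rule exI[of _ "mat 1"]) (simp add: Y_def invertible_one)
  have D: "open ?D"
    by (intro open_Collect_less continuous_intros)
  have Yc: "Y z $ i $ j = z powi \<kappa> i * Z (1 / z) $ i $ j" for i j z
    by (simp add: Y_def matrix_mult_component if_distrib if_distribR sum.delta cong: if_cong)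
  have "1 / \<delta> > 0" using \<delta> by simp
  then have z0: "z \<noteq> 0" using z by auto
  have zb: "1 / z \<in> ball 0 \<delta>"
    using z \<delta> z0 by (simp add: norm_divide field_simps)
  have d1: "((\<lambda>w. Y w $ i $ j) has_field_derivative (A z ** Y z) $ i $ j) (at z)"
    using solution_has_field_derivative[OF sol D, of z 1] z by simp
  have dZ1: "((\<lambda>z. Z z $ i $ j) has_field_derivative deriv_mat Z (1 / z) $ i $ j) (at (1 / z))"
    using Z holomorphic_derivI[OF _ open_ball zb, of "\<lambda>z. Z z $ i $ j"]
    by (simp add: analytic_invertible_def deriv_mat_def)
  have "((\<lambda>z. 1 / z) has_field_derivative - 1 / z\<^sup>2) (at z)"
    using z0 by (auto intro!: derivative_eq_intros simp: power2_eq_square)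
  from DERIV_chain2[where g = "\<lambda>z. 1 / z", OF dZ1 this] have dZ: "((\<lambda>z. Z (1 / z) $ i $ j) has_field_derivative
      deriv_mat Z (1 / z) $ i $ j * (- 1 / z\<^sup>2)) (at z)" .
  have "((\<lambda>z. z powi \<kappa> i) has_field_derivative of_int (\<kappa> i) * z powi (\<kappa> i - 1)) (at z)"
    using z0 by (auto intro!: derivative_eq_intros)
  from DERIV_mult[OF this dZ] have "((\<lambda>w. Y w $ i $ j) has_field_derivative
      of_int (\<kappa> i) * z powi (\<kappa> i - 1) * Z (1 / z) $ i $ j
      + deriv_mat Z (1 / z) $ i $ j * (- 1 / z\<^sup>2) * z powi \<kappa> i) (at z)"
    by (simp add: Yc)
  from DERIV_unique[OF d1 this]
  have "(\<Sum>l\<in>UNIV. A z $ i $ l * (z powi \<kappa> l * Z (1 / z) $ l $ j))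
      = of_int (\<kappa> i) * z powi (\<kappa> i - 1) * Z (1 / z) $ i $ j
      + deriv_mat Z (1 / z) $ i $ j * (- 1 / z\<^sup>2) * z powi \<kappa> i"
    by (simp add: matrix_mult_component Yc)
  then have eq: "(\<Sum>l\<in>UNIV. A z $ i $ l * (z powi \<kappa> l * Z (1 / z) $ l $ j)) * inverse p
      = (of_int (\<kappa> i) * (p / z) * Z (1 / z) $ i $ j
      + deriv_mat Z (1 / z) $ i $ j * (- 1 / z\<^sup>2) * p) * inverse p" if "p = z powi \<kappa> i" for p
    using z0 that by (simp add: power_int_diff)
  have p: "z powi \<kappa> i \<noteq> 0"
    using z0 by simp
  have "(\<Sum>l\<in>UNIV. A z $ i $ l * z powi (\<kappa> l - \<kappa> i) * Z (1 / z) $ l $ j)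
    = (\<Sum>l\<in>UNIV. A z $ i $ l * (z powi \<kappa> l * Z (1 / z) $ l $ j)) * inverse (z powi \<kappa> i)"
    unfolding sum_distrib_right using z0 by (intro sum.cong) (simp_all add: power_int_diff divide_inverse)
  also have "\<dots> = of_int (\<kappa> i) / z * Z (1 / z) $ i $ j - deriv_mat Z (1 / z) $ i $ j / z\<^sup>2"
  proof -
    have "(c * (p / z) * u + d * (- 1 / z\<^sup>2) * p) * inverse p = c / z * u - d / z\<^sup>2"
      if "p \<noteq> 0" for c p u d
      using that z0 by (simp add: field_simps)
    then show ?thesis
      unfolding eq[OF refl] using p by blast
  qed
  finally show ?thesis .
qed


section \<open>Residues of the system\<close>

text \<open>By Riemann's theorem all singularities are removable, so \<open>f\<close> extends to an
  entire function tending to 0 at infinity, and Liouville's theorem applies.\<close>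

lemma holomorphic_off_finite_eq_0:
  fixes f :: "complex \<Rightarrow> complex"
  assumes S: "finite S" and holo: "f holomorphic_on (- S)"
    and sing: "\<And>s. s \<in> S \<Longrightarrow> ((\<lambda>z. (z - s) * f z) \<longlongrightarrow> 0) (at s)"
    and inf: "(f \<longlongrightarrow> 0) at_infinity" and z: "z \<notin> S"
  shows "f z = 0"
proof -
  have bdd: "f \<in> O[at s](\<lambda>_. 1)" if s: "s \<in> S" for s
  proof -
    define U where "U = - (S - {s})"
    have "open U"
      unfolding U_def by (intro open_Compl finite_imp_closed finite_Diff S)
    then have U: "open U" "s \<in> interior U"
      by (auto simp: U_def interior_open)
    have "U - {s} = - S" using s by (auto simp: U_def)
    then have "f holomorphic_on U - {s}" using holo by simp
    from iffD2[OF holomorphic_on_extend_lim[OF this U(2)] sing[OF s]]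
    obtain g where g: "g holomorphic_on U" "\<And>w. w \<in> U - {s} \<Longrightarrow> g w = f w"
      by auto
    have sU: "s \<in> U" by (simp add: U_def)
    have "(g \<longlongrightarrow> g s) (at s)"
      using holomorphic_on_imp_continuous_on[OF g(1)] U sU
      by (metis at_within_open continuous_on)
    moreover have "\<forall>\<^sub>F w in at s. g w = f w"
      using eventually_at_in_open[OF U(1) sU] by eventually_elim (simp add: g(2))
    ultimately have "(f \<longlongrightarrow> g s) (at s)"
      by (rule Lim_transform_eventually)
    then show ?thesis
      by (intro bigoI_tendsto[where c = "g s"]) auto
  qed
  have "S \<subseteq> interior UNIV" "f holomorphic_on (UNIV - S)"
    using holo by (auto simp: Compl_eq_Diff_UNIV)
  from removable_singularities[OF S this bdd]
  obtain g where g: "g holomorphic_on UNIV" "\<And>w. w \<notin> S \<Longrightarrow> g w = f w"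
    by auto
  have "\<forall>\<^sub>F w in at_infinity. \<forall>s\<in>S. w \<noteq> s"
    using S by (intro eventually_ball_finite ballI eventually_not_equal_at_infinity)
  then have "\<forall>\<^sub>F w in at_infinity. f w = g w"
    by eventually_elim (use g(2) in auto)
  then have "(g \<longlongrightarrow> 0) at_infinity"
    by (rule Lim_transform_eventually[OF inf])
  then show ?thesis
    using Liouville_weak_0[OF g(1), of z] g(2)[OF z] by simp
qed

lemma shifted_inverse_at_infinity: "((\<lambda>z::complex. 1 / (z - c)) \<longlongrightarrow> 0) at_infinity"
proof -
  have "filterlim (\<lambda>z. - c + z) at_infinity (at_infinity :: complex filter)"
    by (rule tendsto_add_filterlim_at_infinity[OF tendsto_const filterlim_ident])
  from filterlim_compose[OF tendsto_inverse_0 this]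
  have "((\<lambda>z. inverse (- c + z)) \<longlongrightarrow> 0) at_infinity" .
  then show ?thesis by (simp add: inverse_eq_divide)
qed

text \<open>Subtracting all principal parts leaves only removable singularities and keeps the limit
  0 at infinity, so \<open>holomorphic_off_finite_eq_0\<close> applies to the difference.\<close>

lemma partial_fractions:
  fixes f :: "complex \<Rightarrow> complex" and a :: "'k::finite \<Rightarrow> complex"
  assumes a: "inj a" and holo: "f holomorphic_on (- range a)"
    and sing: "\<And>k. ((\<lambda>z. (z - a k) * f z) \<longlongrightarrow> r k) (at (a k))"
    and inf: "(f \<longlongrightarrow> 0) at_infinity" and z: "z \<notin> range a"
  shows "f z = (\<Sum>k\<in>UNIV. r k / (z - a k))"
proof -
  define h where "h z = f z - (\<Sum>k\<in>UNIV. r k / (z - a k))" for z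
  have "h z = 0"
  proof (rule holomorphic_off_finite_eq_0[of "range a" h z])
    show "h holomorphic_on - range a"
      unfolding h_def by (intro holomorphic_intros holo) auto
    have "((\<lambda>z. f z - (\<Sum>k\<in>UNIV. r k * (1 / (z - a k)))) \<longlongrightarrow> 0 - (\<Sum>k\<in>(UNIV::'k set). r k * 0)) at_infinity"
      by (intro tendsto_intros inf shifted_inverse_at_infinity)
    then show "(h \<longlongrightarrow> 0) at_infinity"
      by (simp add: h_def[abs_def])
    fix s assume "s \<in> range a"
    then obtain k where k: "s = a k" by auto
    have "((\<lambda>z. (z - s) * f z - (r k + (\<Sum>l\<in>UNIV - {k}. (z - s) * (r l / (z - a l)))))
        \<longlongrightarrow> r k - (r k + (\<Sum>l\<in>UNIV - {k}. (s - s) * (r l / (s - a l))))) (at s)"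
      using a unfolding k by (intro tendsto_intros sing) (auto simp: inj_def)
    moreover have "\<forall>\<^sub>F z in at s. (z - s) * f z - (r k + (\<Sum>l\<in>UNIV - {k}. (z - s) * (r l / (z - a l)))) = (z - s) * h z"
    proof (rule eventually_mono[OF eventually_neq_at_within[of s]])
      fix z assume "z \<noteq> s"
      have "(\<Sum>k\<in>UNIV. r k / (z - a k)) = r k / (z - s) + (\<Sum>l\<in>UNIV - {k}. r l / (z - a l))"
        unfolding k by (rule sum.remove) auto
      then have "(z - s) * h z = (z - s) * f z - ((z - s) * (r k / (z - s)) + (\<Sum>l\<in>UNIV - {k}. (z - s) * (r l / (z - a l))))"
        unfolding h_def right_diff_distrib by (simp only: distrib_left sum_distrib_left)
      then show "(z - s) * f z - (r k + (\<Sum>l\<in>UNIV - {k}. (z - s) * (r l / (z - a l)))) = (z - s) * h z"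
        using \<open>z \<noteq> s\<close> by simp
    qed
    ultimately show "((\<lambda>z. (z - s) * h z) \<longlongrightarrow> 0) (at s)"
      by (simp add: Lim_transform_eventually)
  qed (use z in auto)
  then show ?thesis by (simp add: h_def)
qed

text \<open>The explicit inverse makes continuity in \<open>B\<close> immediate, unlike \<^const>\<open>matrix_inv\<close>.\<close>

definition inv2 :: "complex^2^2 \<Rightarrow> complex^2^2" where
  "inv2 B = (\<chi> i j. (if i = j then (if i = 1 then B $ 2 $ 2 else B $ 1 $ 1) else - (B $ i $ j)) / det B)"

lemma inv2: 
  assumes "invertible B"
  shows "B ** inv2 B = mat 1" "inv2 B ** B = mat 1"
proof -
  have "det B \<noteq> 0"
    using assms by (simp add: invertible_det_nz)
  then show "B ** inv2 B = mat 1"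
    by (simp add: vec_eq_iff forall_2 matrix_mult_component sum_2 inv2_def mat_def field_simps)
      (simp add: det_2 field_simps)
  then show "inv2 B ** B = mat 1"
    by (metis matrix_left_right_inverse)
qed

section \<open>Limits of the local factors and the residues of the coefficient matrix\<close>

lemma tendsto_inv2:
  fixes B :: "complex^2^2" and f :: "'x \<Rightarrow> complex^2^2"
  assumes "\<And>i j. ((\<lambda>x. f x $ i $ j) \<longlongrightarrow> B $ i $ j) F" "invertible B"
  shows "((\<lambda>x. inv2 (f x) $ i $ j) \<longlongrightarrow> inv2 B $ i $ j) F"
proof -
  have "B $ 1 $ 1 * B $ 2 $ 2 - B $ 1 $ 2 * B $ 2 $ 1 \<noteq> 0"
    using assms(2) by (simp add: invertible_det_nz det_2)
  then show ?thesis
    using exhaust_2[of i] exhaust_2[of j]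
    by (auto simp: inv2_def det_2 intro!: tendsto_intros assms(1))
qed

lemma tendsto_matrix_mult:
  fixes f :: "'x \<Rightarrow> complex^'n^'m" and g :: "'x \<Rightarrow> complex^'k^'n"
  assumes "\<And>i j. ((\<lambda>x. f x $ i $ j) \<longlongrightarrow> B $ i $ j) F"
    and "\<And>i j. ((\<lambda>x. g x $ i $ j) \<longlongrightarrow> C $ i $ j) F"
  shows "((\<lambda>x. (f x ** g x) $ i $ j) \<longlongrightarrow> (B ** C) $ i $ j) F"
  unfolding matrix_mult_component by (intro tendsto_intros assms)

lemma tendsto_analytic_invertible:
  fixes Z :: "complex \<Rightarrow> complex^'n^'n"
  assumes "analytic_invertible (ball c \<delta>) Z" "\<delta> > 0"
  shows "((\<lambda>z. Z z $ i $ j) \<longlongrightarrow> Z c $ i $ j) (at c)"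
    and "((\<lambda>z. deriv_mat Z z $ i $ j) \<longlongrightarrow> deriv_mat Z c $ i $ j) (at c)"
proof -
  have h: "(\<lambda>z. Z z $ i $ j) holomorphic_on ball c \<delta>" and c: "c \<in> ball c \<delta>"
    using assms by (auto simp: analytic_invertible_def)
  have lim: "(f \<longlongrightarrow> f c) (at c)" if "f holomorphic_on ball c \<delta>" for f :: "complex \<Rightarrow> complex"
    using holomorphic_on_imp_continuous_on[OF that] c
    by (metis at_within_open continuous_on open_ball)
  show "((\<lambda>z. Z z $ i $ j) \<longlongrightarrow> Z c $ i $ j) (at c)"
    using lim[OF h] .
  show "((\<lambda>z. deriv_mat Z z $ i $ j) \<longlongrightarrow> deriv_mat Z c $ i $ j) (at c)"
    using lim[OF holomorphic_deriv[OF h open_ball]] by (simp add: deriv_mat_def)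
qed

text \<open>Solve the equation of the local factor \<open>Z\<close> for \<open>(z - a) * A z\<close>
  and let \<open>z\<close> tend to \<open>a\<close>: the derivative term disappears, and the residue
  is \<open>E\<close> conjugated by \<open>P = Z a\<close>.\<close>

lemma local_form_at_residue:
  fixes E :: "complex^2^2"
  assumes "local_form_at a E A"
  obtains P where "invertible P"
    "\<And>i j. ((\<lambda>z. (z - a) * A z $ i $ j) \<longlongrightarrow> (P ** E ** inv2 P) $ i $ j) (at a)"
proof -
  have "\<forall>\<^sub>F \<delta> in at_right (0::real). \<delta> > 0 \<and> (\<exists>Z. analytic_invertible (ball a \<delta>) Z \<and>
        (\<forall>Y. solution {w. Re w < ln \<delta>} (\<lambda>w. a + exp w) A Y \<longleftrightarrow>
           (\<exists>C. invertible C \<and>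
              (\<forall>w. Re w < ln \<delta> \<longrightarrow> Y w = Z (a + exp w) ** mexp (mat w ** E) ** C))))"
    by (intro eventually_conj eventually_at_right_less assms[unfolded local_form_at_def])
  from eventually_happens'[OF trivial_limit_at_right_real this]
  obtain \<delta> Z where \<delta>: "\<delta> > 0" and Z: "analytic_invertible (ball a \<delta>) Z"
    and form: "\<And>Y. solution {w. Re w < ln \<delta>} (\<lambda>w. a + exp w) A Y \<longleftrightarrow>
           (\<exists>C. invertible C \<and> (\<forall>w. Re w < ln \<delta> \<longrightarrow> Y w = Z (a + exp w) ** mexp (mat w ** E) ** C))"
    by blast
  have Za: "invertible (Z a)"
    using Z \<delta> by (auto simp: analytic_invertible_def)
  note lim = tendsto_analytic_invertible[OF Z \<delta>]
  have "((\<lambda>z. ((mat (z - a) ** deriv_mat Z z + Z z ** E) ** inv2 (Z z)) $ i $ j)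
      \<longlongrightarrow> (Z a ** E ** inv2 (Z a)) $ i $ j) (at a)" for i j
  proof (rule tendsto_matrix_mult[OF _ tendsto_inv2[OF lim(1) Za]])
    fix i j
    have "((\<lambda>z. (z - a) * deriv_mat Z z $ i $ j + (Z z ** E) $ i $ j)
       \<longlongrightarrow> (a - a) * deriv_mat Z a $ i $ j + (Z a ** E) $ i $ j) (at a)"
      by (intro tendsto_add tendsto_mult lim tendsto_diff tendsto_const tendsto_ident_at tendsto_matrix_mult)
    then show "((\<lambda>z. (mat (z - a) ** deriv_mat Z z + Z z ** E) $ i $ j)
       \<longlongrightarrow> (Z a ** E) $ i $ j) (at a)"
      by (simp add: mat_mult_component)
  qed
  moreover have "\<forall>\<^sub>F z in at a. ((mat (z - a) ** deriv_mat Z z + Z z ** E) ** inv2 (Z z)) $ i $ j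
      = (z - a) * A z $ i $ j" for i j
  proof -
    have "\<forall>\<^sub>F z in at a. z \<in> ball a \<delta> - {a}"
      using \<delta> by (intro eventually_at_in_open) auto
    then show ?thesis
    proof (rule eventually_mono)
      fix z assume z: "z \<in> ball a \<delta> - {a}"
      have "mat (z - a) ** (A z ** Z z) = mat (z - a) ** deriv_mat Z z + Z z ** E"
        using local_form_at_equation[OF Z \<delta> form] z by blast
      then have "(mat (z - a) ** deriv_mat Z z + Z z ** E) ** inv2 (Z z)
         = mat (z - a) ** (A z ** (Z z ** inv2 (Z z)))"
        by (metis matrix_mul_assoc)
      moreover have "invertible (Z z)"
        using Z z by (auto simp: analytic_invertible_def)
      ultimately show "((mat (z - a) ** deriv_mat Z z + Z z ** E) ** inv2 (Z z)) $ i $ j = (z - a) * A z $ i $ j"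
        by (simp add: inv2 mat_mult_component)
    qed
  qed
  ultimately have "((\<lambda>z. (z - a) * A z $ i $ j) \<longlongrightarrow> (Z a ** E ** inv2 (Z a)) $ i $ j) (at a)" for i j
    by (rule Lim_transform_eventually)
  then show ?thesis
    using that Za by blast
qed

text \<open>Conjugated by the diagonal powers, \<open>A\<close> equals the diagonal matrix with
  entries \<open>\<kappa> i / z\<close> up to an error of order \<open>z powi (-2)\<close>. Thus the
  diagonal entries have leading terms \<open>\<kappa> i / z\<close>, while entry 2 1 is of order
  \<open>z powi (\<kappa> 2 - \<kappa> 1 - 2)\<close>.\<close>

lemma local_form_infinity_asymptotics:
  fixes \<kappa> :: "2 \<Rightarrow> int"
  assumes "local_form_infinity \<kappa> A"
  obtains W :: "complex^2^2" where
    "\<And>i m. ((\<lambda>z. z\<^sup>2 * (A z $ i $ m * z powi (\<kappa> m - \<kappa> i)) - (if i = m then of_int (\<kappa> i) * z else 0))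
       \<longlongrightarrow> W $ i $ m) at_infinity"
proof -
  have "\<forall>\<^sub>F \<delta> in at_right (0::real). \<delta> > 0 \<and> (\<exists>Z. analytic_invertible (ball 0 \<delta>) Z \<and>
        (\<forall>Y. solution {z. cmod z > 1 / \<delta>} (\<lambda>z. z) A Y \<longleftrightarrow>
           (\<exists>C. invertible C \<and>
              (\<forall>z. cmod z > 1 / \<delta> \<longrightarrow>
                 Y z = (\<chi> i j. if i = j then z powi \<kappa> i else 0) ** Z (1 / z) ** C))))"
    by (intro eventually_conj eventually_at_right_less assms[unfolded local_form_infinity_def])
  from eventually_happens'[OF trivial_limit_at_right_real this]
  obtain \<delta> Z where \<delta>: "\<delta> > 0" and Z: "analytic_invertible (ball 0 \<delta>) Z"
    and form: "\<And>Y. solution {z. cmod z > 1 / \<delta>} (\<lambda>z. z) A Y \<longleftrightarrow>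
           (\<exists>C. invertible C \<and> (\<forall>z. cmod z > 1 / \<delta> \<longrightarrow>
                 Y z = (\<chi> i j. if i = j then z powi \<kappa> i else 0) ** Z (1 / z) ** C))"
    by blast
  have Z0: "invertible (Z 0)"
    using Z \<delta> by (auto simp: analytic_invertible_def)
  note lim = tendsto_analytic_invertible[OF Z \<delta>]
  have inv: "filterlim (\<lambda>z::complex. 1 / z) (at 0) at_infinity"
    using filterlim_inverse_at_iff[of "\<lambda>z::complex. z" at_infinity]
    by (simp add: filterlim_ident inverse_eq_divide)
  have L: "((\<lambda>z. - (deriv_mat Z (1 / z) ** inv2 (Z (1 / z))) $ i $ m)
      \<longlongrightarrow> - (deriv_mat Z 0 ** inv2 (Z 0)) $ i $ m) at_infinity" for i m
    by (intro tendsto_minus filterlim_compose[OF tendsto_matrix_mult[OF lim(2) tendsto_inv2[OF lim(1) Z0]] inv])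
  have ev: "\<forall>\<^sub>F z in at_infinity. - (deriv_mat Z (1 / z) ** inv2 (Z (1 / z))) $ i $ m
      = z\<^sup>2 * (A z $ i $ m * z powi (\<kappa> m - \<kappa> i)) - (if i = m then of_int (\<kappa> i) * z else 0)" for i m
  proof -
    have "\<forall>\<^sub>F z::complex in at_infinity. cmod z > 1 / \<delta>"
      using filterlim_norm_at_top[where 'a = complex] by (auto simp: filterlim_at_top_dense)
    then show ?thesis
    proof (rule eventually_mono)
      fix z :: complex assume z: "cmod z > 1 / \<delta>"
      have "1 / \<delta> > 0" using \<delta> by simp
      then have z0: "z \<noteq> 0" using z by auto
      have zb: "1 / z \<in> ball 0 \<delta>"
        using z \<delta> z0 by (simp add: norm_divide field_simps)
      then have I: "invertible (Z (1 / z))"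
        using Z by (auto simp: analytic_invertible_def)
      \<comment> \<open>\<open>B\<close> is \<open>A\<close> conjugated by the diagonal powers. With
        \<open>K\<close> the equation at infinity becomes a matrix identity that can be multiplied
        by the inverse of \<open>Z (1 / z)\<close>.\<close>
      define B :: "complex^2^2" where "B = (\<chi> i l. A z $ i $ l * z powi (\<kappa> l - \<kappa> i))"
      define K :: "complex^2^2" where "K = (\<chi> i l. if i = l then of_int (\<kappa> i) / z else 0)"
      have KZ: "(K ** X) $ i $ j = of_int (\<kappa> i) / z * X $ i $ j" for X :: "complex^2^2" and i j
        unfolding matrix_mult_component K_def
        by (simp add: mult_delta_left del: times_divide_eq_left)
      have "B ** Z (1 / z) = K ** Z (1 / z) - mat (1 / z\<^sup>2) ** deriv_mat Z (1 / z)"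
        unfolding vec_eq_iff
      proof (intro allI)
        fix i j
        have "(B ** Z (1 / z)) $ i $ j = (\<Sum>l\<in>UNIV. A z $ i $ l * z powi (\<kappa> l - \<kappa> i) * Z (1 / z) $ l $ j)"
          by (simp add: matrix_mult_component B_def)
        also have "\<dots> = of_int (\<kappa> i) / z * Z (1 / z) $ i $ j - deriv_mat Z (1 / z) $ i $ j / z\<^sup>2"
          by (rule local_form_infinity_equation[OF Z \<delta> form z])
        also have "\<dots> = (K ** Z (1 / z) - mat (1 / z\<^sup>2) ** deriv_mat Z (1 / z)) $ i $ j"
          by (simp add: mat_mult_component KZ)
        finally show "(B ** Z (1 / z)) $ i $ j = (K ** Z (1 / z) - mat (1 / z\<^sup>2) ** deriv_mat Z (1 / z)) $ i $ j" .
      qed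
      then have "(B ** Z (1 / z) + mat (1 / z\<^sup>2) ** deriv_mat Z (1 / z)) ** inv2 (Z (1 / z)) = K ** Z (1 / z) ** inv2 (Z (1 / z))"
        by simp
      then have "B ** (Z (1 / z) ** inv2 (Z (1 / z))) + mat (1 / z\<^sup>2) ** (deriv_mat Z (1 / z) ** inv2 (Z (1 / z)))
          = K ** (Z (1 / z) ** inv2 (Z (1 / z)))"
        by (simp only: matrix_add_mult_distrib matrix_mul_assoc[symmetric])
      then have "B + mat (1 / z\<^sup>2) ** (deriv_mat Z (1 / z) ** inv2 (Z (1 / z))) = K"
        by (simp add: inv2 I)
      then have Bim: "B $ i $ m + 1 / z\<^sup>2 * (deriv_mat Z (1 / z) ** inv2 (Z (1 / z))) $ i $ m = K $ i $ m"
        by (metis mat_mult_component vector_add_component)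
      have e1: "z\<^sup>2 * B $ i $ m = z\<^sup>2 * K $ i $ m - (deriv_mat Z (1 / z) ** inv2 (Z (1 / z))) $ i $ m"
        unfolding Bim[symmetric] using z0 by (simp add: distrib_left)
      have e2: "z\<^sup>2 * K $ i $ m = (if i = m then of_int (\<kappa> i) * z else 0)"
        using z0 by (simp add: K_def power2_eq_square)
      have e3: "B $ i $ m = A z $ i $ m * z powi (\<kappa> m - \<kappa> i)"
        by (simp add: B_def)
      show "- (deriv_mat Z (1 / z) ** inv2 (Z (1 / z))) $ i $ m
        = z\<^sup>2 * (A z $ i $ m * z powi (\<kappa> m - \<kappa> i)) - (if i = m then of_int (\<kappa> i) * z else 0)"
        unfolding e3[symmetric] e2[symmetric] e1 by simp
    qed
  qed
  show ?thesis
  proof (rule that)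
    fix i m
    show "((\<lambda>z. z\<^sup>2 * (A z $ i $ m * z powi (\<kappa> m - \<kappa> i)) - (if i = m then of_int (\<kappa> i) * z else 0))
       \<longlongrightarrow> (\<chi> i m. - (deriv_mat Z 0 ** inv2 (Z 0)) $ i $ m) $ i $ m) at_infinity"
      using Lim_transform_eventually[OF L ev, of i m] by simp
  qed
qed

text \<open>Partial fractions give the diagonal of \<open>A\<close>, and its behaviour at infinity
  the sums of residues. For the lower left entry the number of poles matters: the product of all
  \<open>z - a k\<close> grows at most like \<open>z ^ 3\<close>, whereas a gap
  \<open>\<kappa> 1 - \<kappa> 2 \<ge> 2\<close> makes this entry decay at least like
  \<open>z powi (-4)\<close>.\<close>

lemma system_residues:
  fixes A :: "complex \<Rightarrow> complex^2^2" and a :: "'k::finite \<Rightarrow> complex" and \<kappa> :: "2 \<Rightarrow> int"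
  assumes a: "inj a" and three: "CARD('k) \<le> 3"
    and holo: "\<And>i j. (\<lambda>z. A z $ i $ j) holomorphic_on (- range a)"
    and loc: "\<And>k. local_form_at (a k) (E k) A" and inf: "local_form_infinity \<kappa> A"
  obtains P :: "'k \<Rightarrow> complex^2^2" where
    "\<And>k. invertible (P k)"
    "\<And>i. of_int (\<kappa> i) = (\<Sum>k\<in>UNIV. (P k ** E k ** inv2 (P k)) $ i $ i)"
    "\<And>i z. z \<notin> range a \<Longrightarrow> A z $ i $ i = (\<Sum>k\<in>UNIV. (P k ** E k ** inv2 (P k)) $ i $ i / (z - a k))"
    "\<And>z. \<kappa> 1 - \<kappa> 2 \<ge> 2 \<Longrightarrow> z \<notin> range a \<Longrightarrow> A z $ 2 $ 1 = 0"
    "\<And>k. \<kappa> 1 - \<kappa> 2 \<ge> 2 \<Longrightarrow> (P k ** E k ** inv2 (P k)) $ 2 $ 1 = 0"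
proof -
  have "\<forall>k. \<exists>P. invertible P \<and> (\<forall>i j. ((\<lambda>z. (z - a k) * A z $ i $ j) \<longlongrightarrow> (P ** E k ** inv2 P) $ i $ j) (at (a k)))"
  proof
    fix k
    show "\<exists>P. invertible P \<and> (\<forall>i j. ((\<lambda>z. (z - a k) * A z $ i $ j) \<longlongrightarrow> (P ** E k ** inv2 P) $ i $ j) (at (a k)))"
      by (rule local_form_at_residue[OF loc[of k]]) blast
  qed
  from choice[OF this] obtain P where
    PR: "\<forall>k. invertible (P k) \<and> (\<forall>i j. ((\<lambda>z. (z - a k) * A z $ i $ j) \<longlongrightarrow> (P k ** E k ** inv2 (P k)) $ i $ j) (at (a k)))"
    by blast
  define R where "R k = P k ** E k ** inv2 (P k)" for k
  have P: "\<And>k. invertible (P k)"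
    and R: "\<And>k i j. ((\<lambda>z. (z - a k) * A z $ i $ j) \<longlongrightarrow> R k $ i $ j) (at (a k))"
    using PR unfolding R_def by blast+
  obtain W :: "complex^2^2" where
    W: "\<And>i m. ((\<lambda>z. z\<^sup>2 * (A z $ i $ m * z powi (\<kappa> m - \<kappa> i)) - (if i = m then of_int (\<kappa> i) * z else 0))
       \<longlongrightarrow> W $ i $ m) at_infinity"
    using local_form_infinity_asymptotics[OF inf] by blast
  have inv0: "((\<lambda>z::complex. 1 / z) \<longlongrightarrow> 0) at_infinity"
    using shifted_inverse_at_infinity[of 0] by simp
  have nz: "\<forall>\<^sub>F z::complex in at_infinity. z \<noteq> 0"
    by (rule eventually_not_equal_at_infinity)
  have zA: "((\<lambda>z. z * A z $ i $ i) \<longlongrightarrow> of_int (\<kappa> i)) at_infinity" for i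
  proof -
    have "((\<lambda>z. (z\<^sup>2 * A z $ i $ i - of_int (\<kappa> i) * z) * (1 / z) + of_int (\<kappa> i))
        \<longlongrightarrow> W $ i $ i * 0 + of_int (\<kappa> i)) at_infinity"
      using W[of i i] by (intro tendsto_intros inv0) simp
    moreover have "\<forall>\<^sub>F z in at_infinity. (z\<^sup>2 * A z $ i $ i - of_int (\<kappa> i) * z) * (1 / z) + of_int (\<kappa> i)
        = z * A z $ i $ i"
      using nz by (rule eventually_mono) (simp add: field_simps power2_eq_square)
    ultimately show ?thesis by (simp add: Lim_transform_eventually)
  qed
  have A0: "((\<lambda>z. A z $ i $ i) \<longlongrightarrow> 0) at_infinity" for i
  proof -
    have "((\<lambda>z. z * A z $ i $ i * (1 / z)) \<longlongrightarrow> of_int (\<kappa> i) * 0) at_infinity"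
      by (rule tendsto_mult[OF zA inv0])
    moreover have "\<forall>\<^sub>F z in at_infinity. z * A z $ i $ i * (1 / z) = A z $ i $ i"
      using nz by (rule eventually_mono) simp
    ultimately have "((\<lambda>z. A z $ i $ i) \<longlongrightarrow> of_int (\<kappa> i) * 0) at_infinity"
      by (rule Lim_transform_eventually)
    then show ?thesis by simp
  qed
  have pf: "A z $ i $ i = (\<Sum>k\<in>UNIV. R k $ i $ i / (z - a k))" if "z \<notin> range a" for z i
    by (rule partial_fractions[OF a holo R A0 that])
  have one: "((\<lambda>z. z / (z - c)) \<longlongrightarrow> 1) at_infinity" for c :: complex
  proof -
    have "((\<lambda>z. 1 + c * (1 / (z - c))) \<longlongrightarrow> 1 + c * 0) at_infinity"
      by (intro tendsto_intros shifted_inverse_at_infinity)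
    moreover have "\<forall>\<^sub>F z in at_infinity. 1 + c * (1 / (z - c)) = z / (z - c)"
      by (rule eventually_mono[OF eventually_not_equal_at_infinity[of c]]) (simp add: field_simps)
    ultimately show ?thesis by (simp add: Lim_transform_eventually)
  qed
  have off: "\<forall>\<^sub>F z in at_infinity. z \<notin> range a"
  proof -
    have "\<forall>\<^sub>F z in at_infinity. \<forall>s\<in>range a. z \<noteq> s"
      by (intro eventually_ball_finite ballI eventually_not_equal_at_infinity) auto
    then show ?thesis by (rule eventually_mono) auto
  qed
  have \<kappa>: "of_int (\<kappa> i) = (\<Sum>k\<in>UNIV. R k $ i $ i)" for i
  proof -
    have "((\<lambda>z. \<Sum>k\<in>UNIV. R k $ i $ i * (z / (z - a k))) \<longlongrightarrow> (\<Sum>k\<in>UNIV. R k $ i $ i * 1)) at_infinity"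
      by (intro tendsto_intros one)
    moreover have "\<forall>\<^sub>F z in at_infinity. (\<Sum>k\<in>UNIV. R k $ i $ i * (z / (z - a k))) = z * A z $ i $ i"
      using off by (rule eventually_mono) (simp add: pf sum_distrib_left mult_ac)
    ultimately have "((\<lambda>z. z * A z $ i $ i) \<longlongrightarrow> (\<Sum>k\<in>UNIV. R k $ i $ i)) at_infinity"
      by (simp add: Lim_transform_eventually)
    from tendsto_unique[OF trivial_limit_at_infinity zA this] show ?thesis .
  qed
  have A21: "A z $ 2 $ 1 = 0" if \<kappa>2: "\<kappa> 1 - \<kappa> 2 \<ge> 2" and z: "z \<notin> range a" for z
  proof -
    define h where "h z = A z $ 2 $ 1 * (\<Prod>k\<in>UNIV. z - a k)" for z
    have "h z = 0"
    proof (rule holomorphic_off_finite_eq_0[of "range a" h z])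
      show "h holomorphic_on - range a"
        unfolding h_def by (intro holomorphic_intros holo)
      show "((\<lambda>z. (z - s) * h z) \<longlongrightarrow> 0) (at s)" if s: "s \<in> range a" for s
      proof -
        obtain k where k: "s = a k" using s by auto
        have "((\<lambda>z. ((z - a k) * A z $ 2 $ 1) * (\<Prod>k\<in>UNIV. z - a k))
            \<longlongrightarrow> R k $ 2 $ 1 * (\<Prod>l\<in>UNIV. a k - a l)) (at (a k))"
          by (intro tendsto_intros R)
        moreover have "(\<Prod>l\<in>UNIV. a k - a l) = 0"
          by (rule prod_zero) auto
        ultimately show ?thesis by (simp add: h_def k mult_ac)
      qed
      \<comment> \<open>\<open>d\<close> is the excess of the gap over 2. The entry is of order
        \<open>z powi (- d - 4)\<close>, so \<open>h\<close> still has
        \<open>d + 4 - CARD('k)\<close> factors \<open>1 / z\<close> to spare, a positive number by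
        \<open>three\<close>.\<close>
      define d where "d = nat (\<kappa> 1 - \<kappa> 2 - 2)"
      have d: "\<kappa> 1 - \<kappa> 2 = int d + 2" using \<kappa>2 by (simp add: d_def)
      have "((\<lambda>z. (\<Prod>k\<in>UNIV. (z - a k) * (1 / z))) \<longlongrightarrow> (\<Prod>k\<in>(UNIV::'k set). 1)) at_infinity"
      proof (intro tendsto_prod)
        fix k
        have "((\<lambda>z. 1 - a k * (1 / z)) \<longlongrightarrow> 1 - a k * 0) at_infinity"
          by (intro tendsto_intros inv0)
        moreover have "\<forall>\<^sub>F z in at_infinity. 1 - a k * (1 / z) = (z - a k) * (1 / z)"
          using nz by (rule eventually_mono) (simp add: field_simps)
        ultimately show "((\<lambda>z. (z - a k) * (1 / z)) \<longlongrightarrow> 1) at_infinity"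
          by (simp add: Lim_transform_eventually)
      qed
      then have "((\<lambda>z. (z\<^sup>2 * (A z $ 2 $ 1 * z powi (\<kappa> 1 - \<kappa> 2))) * (1 / z) ^ (d + 4 - CARD('k))
          * (\<Prod>k\<in>UNIV. (z - a k) * (1 / z))) \<longlongrightarrow> W $ 2 $ 1 * 0 ^ (d + 4 - CARD('k)) * (\<Prod>k\<in>(UNIV::'k set). 1)) at_infinity"
        using W[of 2 1] by (intro tendsto_mult tendsto_power inv0) simp_all
      moreover have "\<forall>\<^sub>F z in at_infinity. (z\<^sup>2 * (A z $ 2 $ 1 * z powi (\<kappa> 1 - \<kappa> 2))) * (1 / z) ^ (d + 4 - CARD('k))
          * (\<Prod>k\<in>UNIV. (z - a k) * (1 / z)) = h z"
      proof (rule eventually_mono[OF nz])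
        fix z :: complex assume z: "z \<noteq> 0"
        have "z powi (\<kappa> 1 - \<kappa> 2) = z ^ (d + 2)"
          unfolding d by (metis of_nat_add of_nat_numeral power_int_of_nat)
        then have 1: "z\<^sup>2 * (A z $ 2 $ 1 * z powi (\<kappa> 1 - \<kappa> 2)) = A z $ 2 $ 1 * z ^ (d + 4)"
          by (simp add: power_add eval_nat_numeral)
        have 2: "(\<Prod>k\<in>UNIV. (z - a k) * (1 / z)) = (\<Prod>k\<in>UNIV. z - a k) * (1 / z) ^ CARD('k)"
          by (simp only: prod.distrib prod_constant)
        have 3: "z ^ (d + 4) * ((1 / z) ^ (d + 4 - CARD('k)) * (1 / z) ^ CARD('k)) = 1"
        proof -
          have "(1 / z) ^ (d + 4 - CARD('k)) * (1 / z) ^ CARD('k) = (1 / z) ^ (d + 4)"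
            using three by (simp only: power_add[symmetric]) simp
          then show ?thesis
            using z by (simp only: power_mult_distrib[symmetric]) simp
        qed
        have "(z\<^sup>2 * (A z $ 2 $ 1 * z powi (\<kappa> 1 - \<kappa> 2))) * (1 / z) ^ (d + 4 - CARD('k))
            * (\<Prod>k\<in>UNIV. (z - a k) * (1 / z))
          = h z * (z ^ (d + 4) * ((1 / z) ^ (d + 4 - CARD('k)) * (1 / z) ^ CARD('k)))"
          unfolding 1 2 h_def by (simp only: mult_ac)
        then show "(z\<^sup>2 * (A z $ 2 $ 1 * z powi (\<kappa> 1 - \<kappa> 2))) * (1 / z) ^ (d + 4 - CARD('k))
          * (\<Prod>k\<in>UNIV. (z - a k) * (1 / z)) = h z"
          unfolding 3 by simp
      qed
      ultimately have "(h \<longlongrightarrow> W $ 2 $ 1 * 0 ^ (d + 4 - CARD('k)) * (\<Prod>k\<in>(UNIV::'k set). 1)) at_infinity"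
        by (rule Lim_transform_eventually)
      moreover have "d + 4 - CARD('k) \<noteq> 0"
        using three by simp
      ultimately show "(h \<longlongrightarrow> 0) at_infinity"
        by (simp add: power_0_left)
    qed (use z in auto)
    moreover have "(\<Prod>k\<in>UNIV. z - a k) \<noteq> 0"
      using z by auto
    ultimately show ?thesis by (simp add: h_def)
  qed
  have R21: "R k $ 2 $ 1 = 0" if \<kappa>2: "\<kappa> 1 - \<kappa> 2 \<ge> 2" for k
  proof -
    define U where "U = - (range a - {a k})"
    have U: "open U" "a k \<in> U"
      unfolding U_def by (intro open_Compl finite_imp_closed finite_Diff) auto
    have "\<forall>\<^sub>F z in at (a k). (z - a k) * A z $ 2 $ 1 = 0"
      using eventually_at_in_open[OF U]
    proof (rule eventually_mono)
      fix z assume "z \<in> U - {a k}"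
      then have "z \<notin> range a" by (auto simp: U_def)
      then show "(z - a k) * A z $ 2 $ 1 = 0" using A21[OF \<kappa>2] by simp
    qed
    then have "((\<lambda>z. 0) \<longlongrightarrow> R k $ 2 $ 1) (at (a k))"
      by (rule Lim_transform_eventually[OF R])
    then show ?thesis
      by (simp add: tendsto_const_iff)
  qed
  show ?thesis
    using that[of P] P \<kappa> pf A21 R21 unfolding R_def by blast
qed

section \<open>Eigenvalues, traces and invariant lines of 2 by 2 matrices\<close>

lemma matrix_inv_right_left:
  fixes C :: "complex^'n^'n"
  assumes "invertible C"
  shows "C ** matrix_inv C = mat 1" "matrix_inv C ** C = mat 1"
proof -
  have "\<exists>B. C ** B = mat 1 \<and> B ** C = mat 1"
    using assms unfolding invertible_def .
  from someI_ex[OF this] show "C ** matrix_inv C = mat 1" "matrix_inv C ** C = mat 1"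
    unfolding matrix_inv_def by auto
qed

lemma mem_similarity_class: "M \<in> similarity_class (M :: 'k \<Rightarrow> complex^'n^'n)"
proof -
  have "matrix_inv (mat 1 :: complex^'n^'n) = mat 1"
    using matrix_inv_right_left(1)[OF invertible_one] by simp
  then show ?thesis
    unfolding similarity_class_def using invertible_one by (intro CollectI exI[of _ "mat 1"]) simp
qed

lemma invertible_mult_nonzero:
  fixes B :: "complex^'n^'n"
  assumes "invertible B" "v \<noteq> 0"
  shows "B *v v \<noteq> 0"
proof
  assume 0: "B *v v = 0"
  obtain C where "C ** B = mat 1" using assms(1) unfolding invertible_def by blast
  then have "v = C *v (B *v v)" by (simp add: matrix_vector_mul_assoc)
  then show False using assms(2) 0 by simp
qed

lemma mult_vec_2: "((B::complex^2^2) *v v) $ i = B $ i $ 1 * v $ 1 + B $ i $ 2 * v $ 2"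
  by (simp add: matrix_vector_mult_def sum_2)

lemma vec_2_eq_iff: "(v::complex^2) = w \<longleftrightarrow> v $ 1 = w $ 1 \<and> v $ 2 = w $ 2"
  by (simp add: vec_eq_iff forall_2)

lemma eigenvector_equations:
  fixes p q r s l x y :: complex
  shows "(p - l) * x + q * y = 0 \<longleftrightarrow> p * x + q * y = l * x"
    and "r * x + (s - l) * y = 0 \<longleftrightarrow> r * x + s * y = l * y"
  by (auto simp: algebra_simps)

text \<open>The characteristic equation. Cramer's rule shows that the determinant annihilates every
  kernel vector; conversely, a nonzero row of the singular matrix provides an eigenvector orthogonal
  to it in the bilinear sense.\<close>

lemma eigenvalue_iff_2:
  fixes B :: "complex^2^2"
  shows "l \<in> eigenvalues B \<longleftrightarrow> (B $ 1 $ 1 - l) * (B $ 2 $ 2 - l) = B $ 1 $ 2 * B $ 2 $ 1"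
proof
  assume "l \<in> eigenvalues B"
  then obtain v where v: "v \<noteq> 0" "B *v v = l *s v"
    unfolding eigenvalues_def by blast
  have 1: "(B $ 1 $ 1 - l) * v $ 1 + B $ 1 $ 2 * v $ 2 = 0" "B $ 2 $ 1 * v $ 1 + (B $ 2 $ 2 - l) * v $ 2 = 0"
    using v(2) unfolding vec_2_eq_iff mult_vec_2 eigenvector_equations by simp_all
  have det: "((p * s - q * r) * x = 0) \<and> ((p * s - q * r) * y = 0)"
    if "p * x + q * y = 0" "r * x + s * y = 0" for p q r s x y :: complex
  proof -
    have "(p * s - q * r) * x = s * (p * x + q * y) - q * (r * x + s * y)"
      "(p * s - q * r) * y = p * (r * x + s * y) - r * (p * x + q * y)"
      by (simp_all add: distrib_left left_diff_distrib)
    then show ?thesis using that by simp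
  qed
  have "v $ 1 \<noteq> 0 \<or> v $ 2 \<noteq> 0"
    using v(1) unfolding vec_2_eq_iff by simp
  then show "(B $ 1 $ 1 - l) * (B $ 2 $ 2 - l) = B $ 1 $ 2 * B $ 2 $ 1"
    using det[OF 1] by auto
next
  assume eq: "(B $ 1 $ 1 - l) * (B $ 2 $ 2 - l) = B $ 1 $ 2 * B $ 2 $ 1"
  have ev: "l \<in> eigenvalues B"
    if "x \<noteq> 0 \<or> y \<noteq> 0" "(B $ 1 $ 1 - l) * x + B $ 1 $ 2 * y = 0" "B $ 2 $ 1 * x + (B $ 2 $ 2 - l) * y = 0" for x y
  proof -
    have "B $ 1 $ 1 * x + B $ 1 $ 2 * y = l * x" "B $ 2 $ 1 * x + B $ 2 $ 2 * y = l * y"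
      using that(2,3) unfolding eigenvector_equations .
    then have "B *v vector [x, y] = l *s vector [x, y]"
      unfolding vec_2_eq_iff mult_vec_2 by (simp add: vector_2)
    moreover have "(vector [x, y] :: complex^2) \<noteq> 0"
      using that(1) unfolding vec_2_eq_iff by (simp add: vector_2)
    ultimately show ?thesis unfolding eigenvalues_def by blast
  qed
  consider "B $ 1 $ 2 \<noteq> 0 \<or> B $ 1 $ 1 - l \<noteq> 0" | "B $ 2 $ 2 - l \<noteq> 0 \<or> B $ 2 $ 1 \<noteq> 0"
    | "B $ 1 $ 2 = 0" "B $ 1 $ 1 - l = 0" "B $ 2 $ 2 - l = 0" "B $ 2 $ 1 = 0"
    by blast
  then show "l \<in> eigenvalues B"
  proof cases
    case 1
    show ?thesis
    proof (rule ev[of "- (B $ 1 $ 2)" "B $ 1 $ 1 - l"])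
      show "B $ 2 $ 1 * - (B $ 1 $ 2) + (B $ 2 $ 2 - l) * (B $ 1 $ 1 - l) = 0"
        using eq by (simp add: mult.commute)
    qed (use 1 in \<open>auto simp: mult.commute\<close>)
  next
    case 2
    show ?thesis
    proof (rule ev[of "B $ 2 $ 2 - l" "- (B $ 2 $ 1)"])
      show "(B $ 1 $ 1 - l) * (B $ 2 $ 2 - l) + B $ 1 $ 2 * - (B $ 2 $ 1) = 0"
        using eq by simp
    qed (use 2 in \<open>auto simp: mult.commute\<close>)
  next
    case 3
    show ?thesis by (rule ev[of 1 0]) (use 3 in auto)
  qed
qed

text \<open>The characteristic equation is symmetric under \<open>l \<mapsto> trace B - l\<close>,
  so this map sends \<open>{x, y}\<close> into itself. If it fixes both points, then
  \<open>x = y\<close>, which settles the double eigenvalue.\<close>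

lemma trace_eq_sum_eigenvalues:
  fixes B :: "complex^2^2"
  assumes "eigenvalues B = {x, y}"
  shows "trace B = x + y"
proof -
  have tr: "trace B = B $ 1 $ 1 + B $ 2 $ 2" by (simp add: trace_def sum_2)
  have other: "trace B - l \<in> {x, y}" if "l \<in> {x, y}" for l
  proof -
    have "l \<in> eigenvalues B" using that assms by simp
    then have "trace B - l \<in> eigenvalues B"
      unfolding eigenvalue_iff_2 tr by (simp add: algebra_simps)
    then show ?thesis using assms by simp
  qed
  from other[of x] other[of y] show ?thesis by auto
qed

text \<open>For the second part: the first unit vector is an eigenvector of the triangular
  conjugate, and \<open>inv2 P\<close> carries it to an eigenvector of \<open>E\<close>.\<close>

lemma similar_residue:
  fixes E P :: "complex^2^2"
  assumes P: "invertible P"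
  shows "trace (P ** E ** inv2 P) = trace E"
    and "(P ** E ** inv2 P) $ 2 $ 1 = 0 \<Longrightarrow> (P ** E ** inv2 P) $ 1 $ 1 \<in> eigenvalues E"
proof -
  have "trace (P ** E ** inv2 P) = trace (inv2 P ** (P ** E))"
    by (rule trace_mul_sym)
  also have "inv2 P ** (P ** E) = E"
    by (simp add: matrix_mul_assoc inv2[OF P])
  finally show "trace (P ** E ** inv2 P) = trace E" .
next
  let ?R = "P ** E ** inv2 P"
  assume 0: "?R $ 2 $ 1 = 0"
  define u :: "complex^2" where "u = inv2 P *v axis 1 1"
  have "invertible (inv2 P)"
    using inv2[OF P] unfolding invertible_def by blast
  then have "u \<noteq> 0"
    unfolding u_def by (rule invertible_mult_nonzero) (simp add: axis_eq_0_iff)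
  have R: "?R *v axis 1 1 = ?R $ 1 $ 1 *s axis 1 1"
    unfolding vec_2_eq_iff mult_vec_2 using 0 by (simp add: axis_def)
  have "E *v u = inv2 P *v (?R *v axis 1 1)"
  proof -
    have "inv2 P ** ?R = E ** inv2 P"
      by (simp add: matrix_mul_assoc inv2[OF P])
    then show ?thesis unfolding u_def matrix_vector_mul_assoc by simp
  qed
  also have "\<dots> = ?R $ 1 $ 1 *s u"
    unfolding R u_def by (rule vec.scale)
  finally show "?R $ 1 $ 1 \<in> eigenvalues E"
    using \<open>u \<noteq> 0\<close> unfolding eigenvalues_def by blast
qed

lemma kernel_row_subspace: "vec.subspace {v. ((B::complex^'n^'m) *v v) $ i = 0}"
  unfolding vec.subspace_def
  by (simp add: matrix_vector_right_distrib vec.scale)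

text \<open>The second row of an invertible matrix is nonzero, so it annihilates exactly a
  line.\<close>

lemma kernel_row_nontrivial:
  assumes "invertible (B::complex^2^2)"
  shows "{v. (B *v v) $ 2 = 0} \<noteq> {0}" "{v. (B *v v) $ 2 = 0} \<noteq> UNIV"
proof -
  have row: "B $ 2 $ 1 \<noteq> 0 \<or> B $ 2 $ 2 \<noteq> 0"
    using assms by (auto simp: invertible_det_nz det_2)
  have "vector [B $ 2 $ 2, - (B $ 2 $ 1)] \<in> {v. (B *v v) $ 2 = 0}"
    by (simp add: mult_vec_2 vector_2)
  moreover have "(vector [B $ 2 $ 2, - (B $ 2 $ 1)] :: complex^2) \<noteq> 0"
    using row unfolding vec_2_eq_iff by (auto simp: vector_2)
  ultimately show "{v. (B *v v) $ 2 = 0} \<noteq> {0}" by blast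
  have "(B *v axis 1 1) $ 2 = B $ 2 $ 1" "(B *v axis 2 1) $ 2 = B $ 2 $ 2"
    by (simp_all add: mult_vec_2 axis_def)
  then show "{v. (B *v v) $ 2 = 0} \<noteq> UNIV"
    using row by (metis (mono_tags, lifting) UNIV_I mem_Collect_eq)
qed

text \<open>Lets uniqueness of the invariant subspace identify the line of a common eigenvector. The
  span is proper because the two unit vectors cannot both be multiples of \<open>v\<close>.\<close>

lemma eigenline_invariant:
  fixes M :: "'k \<Rightarrow> complex^2^2"
  assumes v: "v \<noteq> 0" and eig: "\<And>k. M k *v v = c k *s v"
  shows "nontrivial_invariant_subspace M (vec.span {v})"
  unfolding nontrivial_invariant_subspace_def
proof (intro conjI allI ballI)
  show "vec.subspace (vec.span {v})" by (rule vec.subspace_span)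
  show "vec.span {v} \<noteq> {0}" using v vec.span_base[of v "{v}"] by auto
  fix k w assume "w \<in> vec.span {v}"
  then obtain d where w: "w = d *s v" unfolding vec.span_singleton by auto
  have "M k *v w = (d * c k) *s v"
    unfolding w vec.scale eig by (simp add: vector_smult_assoc)
  then show "M k *v w \<in> vec.span {v}"
    unfolding vec.span_singleton by blast
next
  show "vec.span {v} \<noteq> UNIV"
  proof
    assume "vec.span {v} = UNIV"
    then have "axis 1 1 \<in> vec.span {v}" "axis 2 1 \<in> vec.span {v}" by auto
    then obtain d e where "axis 1 1 = d *s v" "axis 2 1 = e *s v"
      unfolding vec.span_singleton by auto
    then show False
      unfolding vec_2_eq_iff by (auto simp: axis_def)
  qed
qed


section \<open>Continuation on the covering\<close>

lemma continuous_on_Fin: "continuous_on D Fin"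
proof -
  have "continuous_on UNIV Fin"
    by (subst continuous_on_open_vimage) (auto simp: open_riemann_sphere_def)
  then show ?thesis
    by (rule continuous_on_subset) simp
qed

lemma open_Compl_Fin_image: "compact K \<Longrightarrow> open (- Fin ` K)"
proof -
  assume K: "compact K"
  have "Fin -` (- Fin ` K) = - K" by auto
  then show ?thesis
    using K by (simp add: open_riemann_sphere_def compact_imp_closed open_Compl)
qed

lemma sphere_basis:
  assumes "open V" "P \<in> V"
  obtains W where "open W" "P \<in> W" "W \<subseteq> V" "open (Fin -` W)" "connected (Fin -` W)"
proof (cases P)
  case (Fin z)
  have "open (Fin -` V)" "z \<in> Fin -` V"
    using assms Fin by (auto simp: open_riemann_sphere_def)
  then obtain r where r: "r > 0" "ball z r \<subseteq> Fin -` V"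
    unfolding open_contains_ball by blast
  have v: "Fin -` (Fin ` ball z r) = ball z r" by auto
  show ?thesis
  proof (rule that[of "Fin ` ball z r"])
    have "Infty \<notin> Fin ` ball z r" by auto
    then show "open (Fin ` ball z r)"
      unfolding open_riemann_sphere_def v by blast
    show "P \<in> Fin ` ball z r" "Fin ` ball z r \<subseteq> V" using r Fin by auto
    show "open (Fin -` Fin ` ball z r)" "connected (Fin -` Fin ` ball z r)"
      unfolding v by auto
  qed
next
  case Infty
  then have "compact (- (Fin -` V))"
    using assms by (auto simp: open_riemann_sphere_def)
  from compact_imp_bounded[OF this] obtain R where "\<And>x. x \<in> - (Fin -` V) \<Longrightarrow> norm x \<le> R"
    unfolding bounded_iff by blast
  then have R: "- (Fin -` V) \<subseteq> cball 0 R" by auto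
  have v: "Fin -` insert Infty (Fin ` (- cball 0 R)) = - cball 0 R" by auto
  show ?thesis
  proof (rule that[of "insert Infty (Fin ` (- cball 0 R))"])
    show "open (insert Infty (Fin ` (- cball 0 R)))"
      unfolding open_riemann_sphere_def v by (simp add: open_Compl)
    show "P \<in> insert Infty (Fin ` (- cball 0 R))" "insert Infty (Fin ` (- cball 0 R)) \<subseteq> V"
      using R assms Infty by auto
    show "open (Fin -` insert Infty (Fin ` (- cball 0 R)))"
      unfolding v by (simp add: open_Compl)
    show "connected (Fin -` insert Infty (Fin ` (- cball 0 R)))"
      unfolding v by (rule connected_complement_bounded_convex) auto
  qed
qed

text \<open>\<open>N\<close> is a sheet over a connected neighbourhood inside \<open>V\<close>, and \<open>q\<close> inverts \<open>\<rho>\<close> over the finite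
  part \<open>D\<close> of that neighbourhood; for a sheet through a point over infinity \<open>D\<close> is a punctured one.\<close>

definition chart ::
    "'b::topological_space set \<Rightarrow> ('b \<Rightarrow> riemann_sphere) \<Rightarrow> riemann_sphere set \<Rightarrow> 'b set
      \<Rightarrow> complex set \<Rightarrow> (complex \<Rightarrow> 'b) \<Rightarrow> bool" where
  "chart X \<rho> V N D q \<longleftrightarrow>
     openin (top_of_set X) N \<and> open D \<and> connected D \<and> continuous_on D q \<and> Fin ` D \<subseteq> V \<and>
     (\<forall>z\<in>D. q z \<in> N \<and> \<rho> (q z) = Fin z) \<and>
     (\<forall>x\<in>N. \<rho> x \<noteq> Infty \<longrightarrow> fin_part (\<rho> x) \<in> D \<and> q (fin_part (\<rho> x)) = x)"

text \<open>Restrict a local sheet to a neighbourhood from \<open>sphere_basis\<close> inside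
  \<open>V\<close>; \<open>q\<close> is the local inverse of \<open>\<rho>\<close> preceded by
  \<open>Fin\<close>.\<close>

lemma chart_exists:
  assumes cov: "covering_space X \<rho> S" and S: "open S" and x: "x \<in> X" and V: "open V" "\<rho> x \<in> V"
  obtains N D q where "chart X \<rho> V N D q" "x \<in> N"
proof -
  obtain T u q where T: "x \<in> T" "openin (top_of_set X) T"
    and u: "\<rho> x \<in> u" "openin (top_of_set S) u" and hom: "homeomorphism T u \<rho> q"
    using covering_space_local_homeomorphism[OF cov x] by blast
  have "open u" using u(2) S by (simp add: openin_open_eq)
  then have "open (u \<inter> V)" "\<rho> x \<in> u \<inter> V" using u(1) V by auto
  then obtain W where W: "open W" "\<rho> x \<in> W" "W \<subseteq> u \<inter> V" "open (Fin -` W)" "connected (Fin -` W)"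
    by (rule sphere_basis)
  have cX: "continuous_on X \<rho>" using cov by (simp add: covering_space_def)
  have N: "openin (top_of_set X) (T \<inter> (X \<inter> \<rho> -` W))"
    by (rule openin_Int[OF T(2) continuous_openin_preimage_gen[OF cX W(1)]])
  have qc: "continuous_on u q" and qT: "q ` u = T" and rq: "\<And>y. y \<in> u \<Longrightarrow> \<rho> (q y) = y"
    and qr: "\<And>y. y \<in> T \<Longrightarrow> q (\<rho> y) = y"
    using hom by (auto simp: homeomorphism_def)
  have TX: "T \<subseteq> X" using T(2) by (rule openin_imp_subset)
  have "continuous_on (Fin -` W) (q \<circ> Fin)"
    by (rule continuous_on_compose[OF continuous_on_Fin continuous_on_subset[OF qc]]) (use W(3) in auto)
  then have "chart X \<rho> V (T \<inter> (X \<inter> \<rho> -` W)) (Fin -` W) (\<lambda>z. q (Fin z))"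
    unfolding chart_def
  proof (intro conjI ballI impI)
    fix z assume z: "z \<in> Fin -` W"
    then have "Fin z \<in> u" using W(3) by auto
    then have "q (Fin z) \<in> T" "\<rho> (q (Fin z)) = Fin z"
      using qT rq by auto
    then show "q (Fin z) \<in> T \<inter> (X \<inter> \<rho> -` W)" "\<rho> (q (Fin z)) = Fin z"
      using TX z by auto
  next
    fix y assume y: "y \<in> T \<inter> (X \<inter> \<rho> -` W)" "\<rho> y \<noteq> Infty"
    then have "Fin (fin_part (\<rho> y)) = \<rho> y"
      by (cases "\<rho> y") auto
    then show "fin_part (\<rho> y) \<in> Fin -` W" "q (Fin (fin_part (\<rho> y))) = y"
      using y qr by auto
  qed (use N W in \<open>auto simp: o_def\<close>)
  moreover have "x \<in> T \<inter> (X \<inter> \<rho> -` W)"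
    using T x W by auto
  ultimately show ?thesis using that by blast
qed

text \<open>A sheet maps a neighbourhood of a point over infinity to a neighbourhood of infinity;
  the complement of the latter is compact, hence not the whole plane.\<close>

lemma finite_points_dense:
  assumes cov: "covering_space X \<rho> S" and S: "open S" and N: "openin (top_of_set X) N" "x \<in> N"
  obtains y where "y \<in> N" "\<rho> y \<noteq> Infty"
proof (cases "\<rho> x = Infty")
  case True
  have x: "x \<in> X" using N openin_imp_subset by blast
  obtain T u q where T: "x \<in> T" "openin (top_of_set X) T"
    and u: "\<rho> x \<in> u" "openin (top_of_set S) u" and hom: "homeomorphism T u \<rho> q"
    using covering_space_local_homeomorphism[OF cov x] by blast
  have "open u" using u(2) S by (simp add: openin_open_eq)
  have TX: "T \<subseteq> X" using T(2) by (rule openin_imp_subset)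
  obtain U where U: "open U" "N = X \<inter> U" using N(1) unfolding openin_open by blast
  then have "N \<inter> T = T \<inter> U" using TX by blast
  then have "openin (top_of_set T) (N \<inter> T)"
    using U(1) unfolding openin_open by blast
  then have "openin (top_of_set u) (u \<inter> q -` (N \<inter> T))"
    using hom by (intro continuous_openin_preimage) (auto simp: homeomorphism_def)
  then have "open (u \<inter> q -` (N \<inter> T))"
    using \<open>open u\<close> by (simp add: openin_open_eq)
  moreover have "Infty \<in> u \<inter> q -` (N \<inter> T)"
    using hom True N T u by (auto simp: homeomorphism_def)
  ultimately have "compact (- (Fin -` (u \<inter> q -` (N \<inter> T))))"
    by (simp add: open_riemann_sphere_def)
  then have "- (Fin -` (u \<inter> q -` (N \<inter> T))) \<noteq> UNIV"
    using not_compact_UNIV[where 'a = complex] by fastforce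
  then obtain z where "Fin z \<in> u" "q (Fin z) \<in> N" by auto
  then show ?thesis
    using hom that[of "q (Fin z)"] by (auto simp: homeomorphism_def)
qed (use that N in auto)

text \<open>A path may be at infinity for an arbitrary closed set of times, so \<open>h\<close> is first extended to the
  points over infinity by its constant value on the surrounding punctured sheet.\<close>

lemma constant_off_infinity:
  assumes cov: "covering_space X \<rho> S" and S: "open S" and T: "connected T" "T \<subseteq> X"
    and loc: "\<And>x. x \<in> T \<Longrightarrow> \<exists>V. open V \<and> \<rho> x \<in> V \<and>
       (\<forall>N D q. chart X \<rho> V N D q \<longrightarrow> (\<lambda>z. h (q z)) constant_on D)"
    and x: "x \<in> T" "\<rho> x \<noteq> Infty" and y: "y \<in> T" "\<rho> y \<noteq> Infty"
  shows "h x = h y"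
proof -
  \<comment> \<open>\<open>c\<close> is the value of \<open>h\<close> on the finite points of
    \<open>N\<close>. Charts give its existence, \<open>finite_points_dense\<close> its independence
    of \<open>N\<close>, so \<open>f\<close> below is well defined over infinity too.\<close>
  define Q where "Q x c N \<longleftrightarrow> openin (top_of_set X) N \<and> x \<in> N \<and> (\<forall>y\<in>N. \<rho> y \<noteq> Infty \<longrightarrow> h y = c)" for x c N
  have ex: "\<exists>c N. Q x c N" if x: "x \<in> T" for x
  proof -
    obtain V where V: "open V" "\<rho> x \<in> V" and const: "\<And>N D q. chart X \<rho> V N D q \<Longrightarrow> (\<lambda>z. h (q z)) constant_on D"
      using loc[OF x] by blast
    obtain N D q where ch: "chart X \<rho> V N D q" and xN: "x \<in> N"
      using chart_exists[OF cov S _ V] x T(2) by blast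
    obtain c where c: "\<And>z. z \<in> D \<Longrightarrow> h (q z) = c"
      using const[OF ch] by (auto simp: constant_on_def)
    have "h y = c" if y: "y \<in> N" "\<rho> y \<noteq> Infty" for y
    proof -
      have "fin_part (\<rho> y) \<in> D" "q (fin_part (\<rho> y)) = y"
        using ch y unfolding chart_def by blast+
      with c[of "fin_part (\<rho> y)"] show ?thesis by simp
    qed
    then have "Q x c N"
      using ch xN unfolding Q_def chart_def by blast
    then show ?thesis by blast
  qed
  have uniq: "c = c'" if "Q x c N" "Q x c' N'" for x c c' N N'
  proof -
    have "openin (top_of_set X) (N \<inter> N')" "x \<in> N \<inter> N'"
      using that by (auto simp: Q_def)
    then obtain y where "y \<in> N \<inter> N'" "\<rho> y \<noteq> Infty"
      by (rule finite_points_dense[OF cov S])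
    then show ?thesis using that by (auto simp: Q_def)
  qed
  define f where "f x = (SOME c. \<exists>N. Q x c N)" for x
  have f: "\<exists>N. Q x (f x) N" if "x \<in> T" for x
    unfolding f_def by (rule someI_ex[OF ex[OF that]])
  have "f constant_on T"
  proof (rule locally_constant_imp_constant[OF T(1)])
    fix x assume x: "x \<in> T"
    obtain N where N: "Q x (f x) N" using f[OF x] by blast
    \<comment> \<open>A neighbourhood that determines the value at \<open>x\<close> does so at each
      of its points.\<close>
    have "f y = f x" if y: "y \<in> T \<inter> N" for y
    proof -
      have "Q y (f x) N" using N y by (auto simp: Q_def)
      moreover obtain N' where "Q y (f y) N'" using f[of y] y by blast
      ultimately show ?thesis using uniq by blast
    qed
    moreover have "openin (top_of_set T) (T \<inter> N)"
      using N T(2) unfolding Q_def openin_open by blast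
    moreover have "x \<in> T \<inter> N"
      using x N by (simp add: Q_def)
    ultimately show "\<exists>U. openin (top_of_set T) U \<and> x \<in> U \<and> (\<forall>y\<in>U. f y = f x)"
      by blast
  qed
  then have fxy: "f x = f y"
    using x(1) y(1) unfolding constant_on_def by metis
  have fh: "f w = h w" if "w \<in> T" "\<rho> w \<noteq> Infty" for w
    using f[OF that(1)] that(2) unfolding Q_def by metis
  show ?thesis
    using fxy unfolding fh[OF x] fh[OF y] .
qed

text \<open>In a chart the coordinate \<open>fin_part (\<rho> x)\<close> becomes \<open>z\<close>
  itself, so the derivative on the covering becomes an ordinary one. As \<open>q\<close> is
  continuous and injective, the limit on the covering may be composed with it.\<close>

lemma chart_solution_derivative:
  fixes Y :: "'b::topological_space \<Rightarrow> complex^'n^'n"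
  assumes sol: "solution (X - \<rho> -` {Infty}) (\<lambda>x. fin_part (\<rho> x)) A Y"
    and ch: "chart X \<rho> V N D q" and z: "z \<in> D"
  shows "((\<lambda>z. (Y (q z) *v v) $ i) has_field_derivative (A z *v (Y (q z) *v v)) $ i) (at z)"
proof -
  let ?X = "X - \<rho> -` {Infty}"
  have N: "N \<subseteq> X" and D: "open D" and qD: "\<And>w. w \<in> D \<Longrightarrow> q w \<in> ?X" and rq: "\<And>w. w \<in> D \<Longrightarrow> \<rho> (q w) = Fin w"
    using ch openin_imp_subset unfolding chart_def by fastforce+
  have "isCont q z"
    using ch z D unfolding chart_def by (simp add: continuous_on_eq_continuous_at)
  then have "(q \<longlongrightarrow> q z) (at z)" by (simp add: isCont_def)
  moreover have "\<forall>\<^sub>F w in at z. q w \<in> ?X \<and> q w \<noteq> q z"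
    using eventually_at_in_open[OF D z]
  proof (rule eventually_mono)
    fix w assume w: "w \<in> D - {z}"
    then have "\<rho> (q w) \<noteq> \<rho> (q z)" using z by (simp add: rq)
    then show "q w \<in> ?X \<and> q w \<noteq> q z" using qD w by auto
  qed
  ultimately have lim: "filterlim q (at (q z) within ?X) (at z)"
    by (simp add: filterlim_at)
  have d: "((\<lambda>z. Y (q z) $ i $ j) has_field_derivative (A z ** Y (q z)) $ i $ j) (at z)" for i j
  proof -
    have "((\<lambda>w. (Y (q w) $ i $ j - Y (q z) $ i $ j) / (fin_part (\<rho> (q w)) - fin_part (\<rho> (q z))))
        \<longlongrightarrow> (A (fin_part (\<rho> (q z))) ** Y (q z)) $ i $ j) (at z)"
      by (rule filterlim_compose[OF solution_component[OF sol qD[OF z]] lim])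
    moreover have "\<forall>\<^sub>F w in at z. (Y (q w) $ i $ j - Y (q z) $ i $ j) / (fin_part (\<rho> (q w)) - fin_part (\<rho> (q z)))
        = (Y (q w) $ i $ j - Y (q z) $ i $ j) / (w - z)"
      using eventually_at_in_open[OF D z] by (rule eventually_mono) (simp add: rq z)
    ultimately show ?thesis
      unfolding has_field_derivative_iff using rq[OF z] by (simp add: Lim_transform_eventually)
  qed
  have "((\<lambda>z. \<Sum>j\<in>UNIV. Y (q z) $ i $ j * v $ j) has_field_derivative
      (\<Sum>j\<in>UNIV. (A z ** Y (q z)) $ i $ j * v $ j)) (at z)"
    by (intro DERIV_sum DERIV_cmult_right d)
  then show ?thesis
    unfolding matrix_vector_mul_assoc by (simp add: matrix_vector_mult_def)
qed


section \<open>Logarithms along the curve\<close>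

lemma C1_differentiable_subpath:
  fixes g :: "real \<Rightarrow> complex"
  assumes "g C1_differentiable_on UNIV"
  shows "subpath u v g C1_differentiable_on UNIV"
proof -
  obtain D where D: "\<And>x. (g has_vector_derivative D x) (at x)" "continuous_on UNIV D"
    using assms unfolding C1_differentiable_on_def by auto
  have "(subpath u v g has_vector_derivative (v - u) *\<^sub>R D ((v - u) * x + u)) (at x)" for x
  proof -
    have "((\<lambda>x. (v - u) * x + u) has_vector_derivative (v - u)) (at x)"
      by (auto intro!: derivative_eq_intros)
    from vector_diff_chain_at[OF this D(1)] show ?thesis
      by (simp add: o_def subpath_def)
  qed
  moreover have "continuous_on UNIV (\<lambda>x. (v - u) *\<^sub>R D ((v - u) * x + u))"
    by (intro continuous_intros continuous_on_compose2[OF D(2)]) auto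
  ultimately show ?thesis
    unfolding C1_differentiable_on_def
    by (intro exI[of _ "\<lambda>x. (v - u) *\<^sub>R D ((v - u) * x + u)"]) simp
qed

text \<open>Differentiation under the integral sign gives the integral of
  \<open>1 / (w - z)\<^sup>2\<close>, and the primitive \<open>- 1 / (w - z)\<close> is evaluated at
  the two ends.\<close>

lemma log_integral_derivative:
  fixes \<gamma> :: "real \<Rightarrow> complex"
  assumes C1: "\<gamma> C1_differentiable_on UNIV" and z: "z \<notin> path_image \<gamma>"
  shows "((\<lambda>z. contour_integral \<gamma> (\<lambda>w. 1 / (w - z))) has_field_derivative
      1 / (z - pathfinish \<gamma>) - 1 / (z - pathstart \<gamma>)) (at z)"
proof -
  have vp: "valid_path \<gamma>"
    unfolding valid_path_def
    by (rule C1_differentiable_imp_piecewise) (use C1 in \<open>auto intro: C1_differentiable_on_subset\<close>)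
  obtain D where D: "\<And>x. (\<gamma> has_vector_derivative D x) (at x)" "continuous_on UNIV D"
    using C1 unfolding C1_differentiable_on_def by auto
  have "compact (D ` {0..1})"
    by (intro compact_continuous_image continuous_on_subset[OF D(2)]) auto
  from compact_imp_bounded[OF this] obtain B where "\<And>x. x \<in> D ` {0..1} \<Longrightarrow> norm x \<le> B"
    unfolding bounded_iff by blast
  then have B: "norm (vector_derivative \<gamma> (at s)) \<le> B" if "s \<in> {0..1}" for s
    using that vector_derivative_at[OF D(1)] by auto
  have "((\<lambda>z. contour_integral \<gamma> (\<lambda>w. 1 / (w - z))) has_field_derivative
      of_nat 1 * contour_integral \<gamma> (\<lambda>w. 1 / (w - z) ^ Suc 1)) (at z)"
  proof (rule Cauchy_next_derivative(2)[where S = UNIV and k = 1 and f' = "\<lambda>_. 1" and B = B])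
    fix w assume "w \<in> UNIV - path_image \<gamma>"
    then show "((\<lambda>u. 1 / (u - w) ^ 1) has_contour_integral contour_integral \<gamma> (\<lambda>u. 1 / (u - w))) \<gamma>"
      using contour_integrable_inversediff[OF vp] by (simp add: has_contour_integral_integral)
  qed (use B vp z in auto)
  moreover have int2: "((\<lambda>w. 1 / (w - z) ^ Suc 1) has_contour_integral
      (- 1 / (pathfinish \<gamma> - z)) - (- 1 / (pathstart \<gamma> - z))) \<gamma>"
  proof (rule contour_integral_primitive[where S = "- {z}"])
    fix w assume "w \<in> - {z}"
    then show "((\<lambda>w. - 1 / (w - z)) has_field_derivative 1 / (w - z) ^ Suc 1) (at w within - {z})"
      by (auto intro!: derivative_eq_intros simp: power2_eq_square)
  qed (use vp z in auto)
  moreover have "contour_integral \<gamma> (\<lambda>w. 1 / (w - z) ^ Suc 1) = 1 / (z - pathfinish \<gamma>) - 1 / (z - pathstart \<gamma>)"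
  proof -
    have flip: "- 1 / (x - z) = 1 / (z - x)" for x
      using minus_divide_right[of 1 "x - z"] by simp
    show ?thesis
      using contour_integral_unique[OF int2] unfolding flip by simp
  qed
  ultimately show ?thesis by simp
qed

section \<open>The three arcs of the curve and their logarithms\<close>

lemma periodic_shift_int:
  assumes "\<And>s::real. g (s + 1) = g s"
  shows "g (s + of_int n) = g s"
proof (induction n rule: int_induct[where k = 0])
  case base
  then show ?case by simp
next
  case (step1 i)
  then show ?case using assms[of "s + of_int i"] by (simp add: add.assoc)
next
  case (step2 i)
  then show ?case using assms[of "s + of_int (i - 1)"] by (simp add: algebra_simps)
qed

text \<open>The last arc ends at \<open>t 1 + 1\<close>, a parameter of the same point as
  \<open>t 1\<close>, so that every arc has an increasing parameter interval.\<close>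

definition arc_end :: "(3 \<Rightarrow> real) \<Rightarrow> 3 \<Rightarrow> real" where
  "arc_end t k = (if k = 3 then t 1 + 1 else t (k + 1))"

definition closed_subarc :: "(real \<Rightarrow> complex) \<Rightarrow> (3 \<Rightarrow> real) \<Rightarrow> 3 \<Rightarrow> complex set" where
  "closed_subarc g t k = g ` {t k .. arc_end t k}"

lemma subarc_eq: "subarc g t k = g ` {t k <..< arc_end t k}"
  by (simp add: subarc_def arc_end_def)

locale curve =
  fixes g :: "real \<Rightarrow> complex" and t :: "3 \<Rightarrow> real" and a :: "3 \<Rightarrow> complex"
  assumes curve: "curve_through g t a"
begin

lemma periodic: "g (s + 1) = g s"
  using curve by (simp add: curve_through_def)

lemma t_less: "t 1 < t 2" "t 2 < t 3" "t 3 < t 1 + 1"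
  using curve by (auto simp: curve_through_def)

lemma a_eq: "a k = g (t k)"
  using curve by (auto simp: curve_through_def)

lemma C1: "g C1_differentiable_on UNIV"
  using curve by (auto simp: curve_through_def)

lemma simple: "simple_path g" "path g" "pathfinish g = pathstart g"
  using curve periodic[of 0] by (auto simp: curve_through_def simple_path_imp_path pathfinish_def pathstart_def)

lemma arc_bounds: "t 1 \<le> t k" "t k < arc_end t k" "arc_end t k \<le> t 1 + 1"
  using exhaust_3[of k] t_less by (auto simp: arc_end_def)

lemma end_a: "g (arc_end t k) = a (k + 1)"
proof -
  have four: "(4 :: 3) = 1" by simp
  show ?thesis
    using exhaust_3[of k] periodic[of "t 1"] by (auto simp: arc_end_def a_eq four)
qed

text \<open>Starting at \<open>a 1\<close> places the three arcs in the parameter interval from 0 to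
  1, as subpaths of one closed path.\<close>

definition turn :: "real \<Rightarrow> complex" where
  "turn = subpath (t 1) (t 1 + 1) g"

lemma turn: "turn s = g (t 1 + s)"
  by (simp add: turn_def subpath_def add.commute)

text \<open>\<open>t 1\<close> is an arbitrary real number; periodicity replaces it by its
  fractional part. Simplicity, image and winding number then carry over from
  \<open>g\<close>.\<close>

lemma turn_shiftpath: "turn = shiftpath (frac (t 1)) g"
proof
  fix s
  have 1: "t 1 + s = frac (t 1) + s + of_int \<lfloor>t 1\<rfloor>" by (simp add: frac_def)
  have "turn s = g (frac (t 1) + s)"
    unfolding turn 1 by (rule periodic_shift_int[where g = g, OF periodic])
  moreover have "g (frac (t 1) + s) = g (frac (t 1) + s - 1)"
    using periodic[of "frac (t 1) + s - 1"] by simp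
  ultimately show "turn s = shiftpath (frac (t 1)) g s"
    by (simp add: shiftpath_def)
qed

lemma frac_in: "frac (t 1) \<in> {0..1}"
  using frac_lt_1[of "t 1"] by (auto simp: frac_ge_0 less_imp_le)

lemma path_image_turn: "path_image turn = path_image g"
  unfolding turn_shiftpath by (rule path_image_shiftpath) (use frac_in simple in auto)

lemma simple_path_turn: "simple_path turn"
  unfolding turn_shiftpath by (rule simple_path_shiftpath) (use frac_in simple in auto)

lemma C1_turn: "turn C1_differentiable_on UNIV"
  unfolding turn_def by (rule C1_differentiable_subpath[OF C1])

lemma valid_path_turn: "valid_path turn"
  unfolding valid_path_def
  by (rule C1_differentiable_imp_piecewise) (use C1_turn in \<open>auto intro: C1_differentiable_on_subset\<close>)

lemma closed_subarc_turn: "closed_subarc g t k = turn ` {t k - t 1 .. arc_end t k - t 1}"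
proof -
  have "{t k .. arc_end t k} = (\<lambda>s. t 1 + s) ` {t k - t 1 .. arc_end t k - t 1}"
    by simp
  then have "g ` {t k .. arc_end t k} = g ` (\<lambda>s. t 1 + s) ` {t k - t 1 .. arc_end t k - t 1}"
    by (rule arg_cong)
  then show ?thesis
    unfolding closed_subarc_def image_image turn .
qed

lemma closed_subarc_subset: "closed_subarc g t k \<subseteq> path_image g"
proof -
  have "turn ` {t k - t 1 .. arc_end t k - t 1} \<subseteq> turn ` {0..1}"
    using arc_bounds[of k] by (intro image_mono) auto
  then show ?thesis
    unfolding path_image_turn[symmetric] closed_subarc_turn by (simp add: path_image_def)
qed

lemma compact_closed_subarc: "compact (closed_subarc g t k)"
  unfolding closed_subarc_def
  by (intro compact_continuous_image C1_differentiable_imp_continuous_on C1_differentiable_on_subset[OF C1]) auto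

text \<open>A simple closed path identifies only its two ends, which is excluded by taking
  \<open>u\<close> strictly between 0 and 1.\<close>

lemma turn_inj:
  assumes "turn u = turn v" "0 < u" "u < 1" "v \<in> {0..1}"
  shows "u = v"
proof -
  have "\<forall>x\<in>{0..1}. \<forall>y\<in>{0..1}. turn x = turn y \<longrightarrow> x = y \<or> x = 0 \<and> y = 1 \<or> x = 1 \<and> y = 0"
    using simple_path_turn unfolding simple_path_def loop_free_def by blast
  from bspec[OF bspec[OF this, of u], of v] show ?thesis
    using assms by auto
qed

text \<open>A point of an open arc has its parameter strictly inside the period, so
  \<open>turn_inj\<close> applies. This keeps the crossing points of a loop off the other two
  arcs.\<close>

lemma subarc_disjoint:
  assumes "j \<noteq> k"
  shows "subarc g t j \<inter> closed_subarc g t k = {}"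
proof -
  have False if u: "t j < u" "u < arc_end t j" and v: "t k \<le> v" "v \<le> arc_end t k" and eq: "g u = g v" for u v
  proof -
    have "u - t 1 = v - t 1"
      using u v eq arc_bounds[of j] arc_bounds[of k] by (intro turn_inj) (auto simp: turn)
    then show False
      using u v assms exhaust_3[of j] exhaust_3[of k] t_less by (auto simp: arc_end_def)
  qed
  then show ?thesis
    by (auto simp: subarc_eq closed_subarc_def)
qed

lemma inj_a: "inj a"
proof -
  have "t j = t k" if "j \<noteq> 1" "a j = a k" for j k
  proof -
    have "t j - t 1 = t k - t 1"
      using that exhaust_3[of j] exhaust_3[of k] t_less by (intro turn_inj) (auto simp: turn a_eq)
    then show ?thesis by simp
  qed
  note eq = this
  have t_inj: "j = k" if "t j = t k" for j k
    using that exhaust_3[of j] exhaust_3[of k] t_less by (elim disjE) simp_all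
  show ?thesis
  proof (rule injI)
    fix j k assume jk: "a j = a k"
    show "j = k"
    proof (cases "j = 1")
      case True
      show ?thesis
      proof (cases "k = 1")
        case False
        then show ?thesis using t_inj[OF eq[OF False jk[symmetric]]] by simp
      qed (use True in simp)
    next
      case False
      then show ?thesis using t_inj[OF eq[OF False jk]] by simp
    qed
  qed
qed

text \<open>A logarithm of \<open>(a (k + 1) - z) / (a k - z)\<close> off the arc. All three
  integrals run along subpaths of \<open>turn\<close>, so that they can be added.\<close>

definition arc_log :: "3 \<Rightarrow> complex \<Rightarrow> complex" where
  "arc_log k z = contour_integral (subpath (t k - t 1) (arc_end t k - t 1) turn) (\<lambda>w. 1 / (w - z))"

lemma arc_log_derivative:
  assumes "z \<notin> closed_subarc g t k"
  shows "(arc_log k has_field_derivative 1 / (z - a (k + 1)) - 1 / (z - a k)) (at z)"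
proof -
  let ?p = "subpath (t k - t 1) (arc_end t k - t 1) turn"
  have "z \<notin> path_image ?p"
    using assms arc_bounds[of k] by (simp add: path_image_subpath closed_subarc_turn)
  from log_integral_derivative[OF C1_differentiable_subpath[OF C1_turn] this]
  show ?thesis
    by (simp add: arc_log_def[abs_def] turn end_a a_eq[of k])
qed

text \<open>The three subpaths join up to \<open>turn\<close>, and moving the starting point of a
  closed path preserves the winding number.\<close>

lemma arc_log_sum:
  assumes z: "z \<notin> path_image g"
  shows "arc_log 1 z + arc_log 2 z + arc_log 3 z = 2 * of_real pi * \<i> * winding_number g z"
proof -
  let ?f = "\<lambda>w. 1 / (w - z)"
  have zt: "z \<notin> path_image turn" using z by (simp add: path_image_turn)
  have int: "?f contour_integrable_on turn"
    by (rule contour_integrable_inversediff[OF valid_path_turn zt])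
  note comb = contour_integral_subpath_combine[OF int valid_path_turn]
  have "arc_log 1 z + arc_log 2 z = contour_integral (subpath 0 (t 3 - t 1) turn) ?f"
    using comb[of 0 "t 2 - t 1" "t 3 - t 1"] t_less by (simp add: arc_log_def arc_end_def)
  then have "arc_log 1 z + arc_log 2 z + arc_log 3 z = contour_integral (subpath 0 1 turn) ?f"
    using comb[of 0 "t 3 - t 1" 1] t_less by (simp add: arc_log_def arc_end_def)
  also have "\<dots> = 2 * of_real pi * \<i> * winding_number turn z"
    using winding_number_valid_path[OF valid_path_turn zt] by simp
  also have "winding_number turn z = winding_number g z"
    unfolding turn_shiftpath by (rule winding_number_shiftpath) (use simple z frac_in in auto)
  finally show ?thesis .
qed

lemma winding_number_inside: "z \<in> inside (path_image g) \<Longrightarrow> winding_number g z = 1"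
  using curve by (simp add: curve_through_def)

lemma winding_number_outside:
  assumes "z \<notin> inside (path_image g)" "z \<notin> path_image g"
  shows "winding_number g z = 0"
proof -
  have "z \<in> outside (path_image g)"
    using assms inside_Un_outside[of "path_image g"] by blast
  then show ?thesis
    using simple by (intro winding_number_zero_in_outside)
qed

end


section \<open>Continuation around a singularity\<close>

text \<open>The constant loops at two points are homotopic; the image of the homotopy is a connected
  set containing both points.\<close>

lemma simply_connected_connected:
  fixes X :: "'b::topological_space set"
  assumes "simply_connected X"
  shows "connected X"
  unfolding connected_iff_connected_component
proof (intro ballI)
  fix x y assume xy: "x \<in> X" "y \<in> X"
  have "homotopic_loops X (\<lambda>_::real. x) (\<lambda>_::real. y)"
    using assms[unfolded simply_connected_def, rule_format, of "\<lambda>_. x" "\<lambda>_. y"] xy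
    by (auto simp: path_def pathfinish_def pathstart_def path_image_def)
  then obtain h :: "real \<times> real \<Rightarrow> 'b" where h: "continuous_on ({0..1} \<times> {0..1}) h" "h \<in> ({0..1} \<times> {0..1}) \<rightarrow> X"
    "\<And>s. s \<in> {0..1} \<Longrightarrow> h (0, s) = x" "\<And>s. s \<in> {0..1} \<Longrightarrow> h (1, s) = y"
    unfolding homotopic_loops by blast
  have "connected (h ` ({0..1} \<times> {0..1}))"
    by (intro connected_continuous_image h(1) convex_connected convex_Times) auto
  moreover have "h ` ({0..1} \<times> {0..1}) \<subseteq> X"
    using h(2) by auto
  moreover have "x \<in> h ` ({0..1} \<times> {0..1})"
    by (rule image_eqI[of _ _ "(0, 0)"]) (use h(3) in auto)
  moreover have "y \<in> h ` ({0..1} \<times> {0..1})"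
    by (rule image_eqI[of _ _ "(1, 0)"]) (use h(4) in auto)
  ultimately show "connected_component X x y"
    unfolding connected_component_def by blast
qed

text \<open>Solutions of the same scalar linear equation are proportional where one of them has no
  zeros, by the quotient rule.\<close>

lemma ratio_constant:
  fixes f G c :: "complex \<Rightarrow> complex"
  assumes D: "open D" "connected D"
    and f: "\<And>z. z \<in> D \<Longrightarrow> (f has_field_derivative c z * f z) (at z)"
    and G: "\<And>z. z \<in> D \<Longrightarrow> (G has_field_derivative c z * G z) (at z)" "\<And>z. z \<in> D \<Longrightarrow> G z \<noteq> 0"
  shows "(\<lambda>z. f z / G z) constant_on D"
proof (rule has_field_derivative_0_imp_constant_on[OF _ D(2,1)])
  fix z assume z: "z \<in> D"
  show "((\<lambda>z. f z / G z) has_field_derivative 0) (at z)"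
    using DERIV_divide[OF f[OF z] G(1)[OF z] G(2)[OF z]] by (simp add: mult_ac)
qed

text \<open>On a disc \<open>c\<close> has a primitive \<open>C\<close>, and \<open>f\<close> is a
  constant multiple of \<open>exp C\<close>, so it vanishes everywhere or nowhere there. The
  argument stays local because \<open>D\<close> may be the exterior of a disc, without a global
  primitive.\<close>

lemma linear_ode_zero_constant:
  fixes f c :: "complex \<Rightarrow> complex"
  assumes D: "open D" "connected D" and c: "c holomorphic_on D"
    and f: "\<And>z. z \<in> D \<Longrightarrow> (f has_field_derivative c z * f z) (at z)"
  shows "(\<lambda>z. f z = 0) constant_on D"
proof (rule locally_constant_imp_constant[OF D(2)])
  fix z assume z: "z \<in> D"
  obtain r where r: "r > 0" "ball z r \<subseteq> D"
    using D(1) z unfolding open_contains_ball by blast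
  obtain C where C: "\<And>w. w \<in> ball z r \<Longrightarrow> (C has_field_derivative c w) (at w within ball z r)"
    by (rule holomorphic_convex_primitive'[OF convex_ball open_ball holomorphic_on_subset[OF c r(2)]]) (rule that)
  have "(\<lambda>w. f w / exp (C w)) constant_on ball z r"
  proof (rule ratio_constant[where c = c])
    fix w assume w: "w \<in> ball z r"
    show "(f has_field_derivative c w * f w) (at w)"
      by (rule f) (use r(2) w in blast)
    have "(C has_field_derivative c w) (at w)"
      using C[OF w] at_within_open[OF w open_ball] by simp
    from DERIV_fun_exp[OF this] show "((\<lambda>w. exp (C w)) has_field_derivative c w * exp (C w)) (at w)"
      by (simp add: mult.commute)
  qed auto
  then obtain k where k: "\<And>w. w \<in> ball z r \<Longrightarrow> f w / exp (C w) = k"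
    unfolding constant_on_def by blast
  have zero: "f w = 0 \<longleftrightarrow> k = 0" if "w \<in> ball z r" for w
    unfolding k[OF that, symmetric] by simp
  have "\<forall>w\<in>ball z r. (f w = 0) = (f z = 0)"
    using zero r(1) by simp
  moreover have "openin (top_of_set D) (ball z r)"
    using r D by (simp add: openin_open_eq)
  moreover have "z \<in> ball z r" using r(1) by simp
  ultimately show "\<exists>T. openin (top_of_set D) T \<and> z \<in> T \<and> (\<forall>w\<in>T. (f w = 0) = (f z = 0))"
    by blast
qed

text \<open>The logarithmic derivative of the product. The integral power needs no choice of
  branch.\<close>

lemma power_exp_derivative:
  fixes F :: "complex \<Rightarrow> complex"
  assumes "(F has_field_derivative d) (at z)" "z \<noteq> c"
  shows "((\<lambda>z. (z - c) powi m * exp (F z)) has_field_derivative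
      (of_int m / (z - c) + d) * ((z - c) powi m * exp (F z))) (at z)"
proof -
  have "((\<lambda>z. (z - c) powi m) has_field_derivative of_int m * (z - c) powi (m - 1)) (at z)"
    using assms(2) by (auto intro!: derivative_eq_intros)
  moreover have "of_int m * (z - c) powi (m - 1) = of_int m / (z - c) * (z - c) powi m"
    using assms(2) by (simp add: power_int_diff)
  ultimately have "((\<lambda>z. (z - c) powi m) has_field_derivative of_int m / (z - c) * (z - c) powi m) (at z)"
    by simp
  from DERIV_mult[OF this DERIV_fun_exp[OF assms(1)]] show ?thesis
    by (simp add: distrib_right distrib_left mult_ac)
qed

section \<open>Transport of scalar solutions along paths in the covering\<close>

lemma chart_domain:
  assumes "covering_space X \<rho> (- Fin ` K)" "chart X \<rho> V N D q" "z \<in> D"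
  shows "z \<notin> K"
proof -
  have "q z \<in> X" "\<rho> (q z) = Fin z"
    using assms(2,3) openin_imp_subset unfolding chart_def by blast+
  then have "Fin z \<in> \<rho> ` X" by force
  then show ?thesis using assms(1) unfolding covering_space_def by blast
qed

text \<open>Over the complement of \<open>K\<close>, \<open>\<psi>\<close> and \<open>G\<close>
  solve the same scalar equation, so their quotient is constant in each chart. By
  \<open>constant_off_infinity\<close> it takes equal values at finite points of \<open>T\<close>,
  even if \<open>T\<close> passes through the fibre over infinity.\<close>

lemma multiplier_along:
  assumes cov: "covering_space X \<rho> (- Fin ` range (a :: 3 \<Rightarrow> complex))"
    and T: "connected T" "T \<subseteq> X" and K: "compact K" "\<And>x. x \<in> T \<Longrightarrow> \<rho> x \<notin> Fin ` K"
    and der: "\<And>V N D q z. chart X \<rho> V N D q \<Longrightarrow> z \<in> D \<Longrightarrow>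
       ((\<lambda>z. \<psi> (q z)) has_field_derivative c z * \<psi> (q z)) (at z)"
    and G: "\<And>z. z \<notin> K \<Longrightarrow> z \<notin> range a \<Longrightarrow> (G has_field_derivative c z * G z) (at z)"
      "\<And>z. z \<notin> K \<Longrightarrow> z \<notin> range a \<Longrightarrow> G z \<noteq> (0::complex)"
    and xy: "x \<in> T" "\<rho> x \<noteq> Infty" "y \<in> T" "\<rho> y \<noteq> Infty"
  shows "\<psi> x / G (fin_part (\<rho> x)) = \<psi> y / G (fin_part (\<rho> y))"
proof -
  have S: "open (- Fin ` range a)"
    by (intro open_Compl_Fin_image finite_imp_compact) simp
  show ?thesis
  proof (rule constant_off_infinity[OF cov S T _ xy])
    fix x assume "x \<in> T"
    show "\<exists>V. open V \<and> \<rho> x \<in> V \<and> (\<forall>N D q. chart X \<rho> V N D q \<longrightarrow>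
        (\<lambda>z. \<psi> (q z) / G (fin_part (\<rho> (q z)))) constant_on D)"
    proof (intro exI[of _ "- Fin ` K"] conjI allI impI)
      show "open (- Fin ` K)" by (rule open_Compl_Fin_image[OF K(1)])
      show "\<rho> x \<in> - Fin ` K" using K(2) \<open>x \<in> T\<close> by simp
      fix N D q assume ch: "chart X \<rho> (- Fin ` K) N D q"
      have D: "open D" "connected D" and rq: "\<And>z. z \<in> D \<Longrightarrow> \<rho> (q z) = Fin z"
        and DK: "\<And>z. z \<in> D \<Longrightarrow> z \<notin> K"
        using ch unfolding chart_def by blast+
      note Da = chart_domain[OF cov ch]
      have "(\<lambda>z. \<psi> (q z) / G z) constant_on D"
        by (rule ratio_constant[where c = c, OF D]) (use der[OF ch] G DK Da in auto)
      then show "(\<lambda>z. \<psi> (q z) / G (fin_part (\<rho> (q z)))) constant_on D"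
        unfolding constant_on_def using rq by simp
    qed
  qed
qed

lemma three_shift: "(k::3) - 1 \<noteq> k" "k + 1 \<noteq> k" "k - 1 \<noteq> k + 1" "k + 1 + 1 = k - 1" "k - 1 + 1 = k"
  using exhaust_3[of k] by auto

lemma sum_three: "(\<Sum>j\<in>UNIV. f j) = f k + f (k + 1) + f (k - 1)" for k :: 3
proof -
  have "card {k, k + 1, k - 1} = 3"
    using three_shift[of k] by simp
  then have "{k, k + 1, k - 1} = UNIV"
    by (intro card_eq_UNIV_imp_eq_UNIV) auto
  then have "(\<Sum>j\<in>UNIV. f j) = (\<Sum>j\<in>{k, k + 1, k - 1}. f j)" by simp
  also have "\<dots> = f k + f (k + 1) + f (k - 1)"
    using three_shift[of k] by (simp add: add.assoc)
  finally show ?thesis .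
qed

context curve
begin

text \<open>As the exponents add up to the integer \<open>m\<close>, the product of the powers
  \<open>(z - a j) powr e j\<close> is formally \<open>(z - a k) powi m\<close> times powers of
  \<open>(z - a (k + 1)) / (z - a k)\<close> and \<open>(z - a (k - 1)) / (z - a k)\<close>. Both
  quotients have logarithms off two of the arcs.\<close>

lemma loop_multiplier:
  fixes \<psi> :: "'b::topological_space \<Rightarrow> complex"
  assumes cov: "covering_space X \<rho> (- Fin ` range a)"
    and loop: "loop_around X \<rho> g t k p" and start: "\<rho> (pathstart p) \<in> Fin ` inside (path_image g)"
    and m: "(\<Sum>j\<in>UNIV. e j) = of_int m"
    and der: "\<And>V N D q z. chart X \<rho> V N D q \<Longrightarrow> z \<in> D \<Longrightarrow>
       ((\<lambda>z. \<psi> (q z)) has_field_derivative (\<Sum>j\<in>UNIV. e j / (z - a j)) * \<psi> (q z)) (at z)"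
  shows "\<psi> (pathfinish p) = exp (2 * of_real pi * \<i> * e k) * \<psi> (pathstart p)"
proof -
  define c where "c z = (\<Sum>j\<in>UNIV. e j / (z - a j))" for z
  \<comment> \<open>\<open>G F1\<close> and \<open>G F2\<close> solve the scalar equation off \<open>K1\<close> and \<open>K2\<close>, respectively.\<close>
  define F1 where "F1 z = e (k + 1) * arc_log k z + e (k - 1) * (arc_log k z + arc_log (k + 1) z)" for z
  define F2 where "F2 z = - e (k - 1) * arc_log (k - 1) z - e (k + 1) * (arc_log (k + 1) z + arc_log (k - 1) z)" for z
  define G where "G F z = (z - a k) powi m * exp (F z)" for F z
  \<comment> \<open>Each set leaves one arc open for crossing: \<open>K1\<close> the arc before
    \<open>a k\<close>, where the loop leaves the interior, \<open>K2\<close> the arc after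
    \<open>a k\<close>, where it returns.\<close>
  define K1 where "K1 = closed_subarc g t k \<union> closed_subarc g t (k + 1)"
  define K2 where "K2 = closed_subarc g t (k - 1) \<union> closed_subarc g t (k + 1)"
  note shift = three_shift[of k]
  \<comment> \<open>The common derivative of \<open>F1\<close> and \<open>F2\<close>, that is,
    \<open>c\<close> without the term \<open>of_int m / (z - a k)\<close>.\<close>
  define d where "d z = e (k + 1) * (1 / (z - a (k + 1)) - 1 / (z - a k)) + e (k - 1) * (1 / (z - a (k - 1)) - 1 / (z - a k))" for z
  have cd: "c z = of_int m / (z - a k) + d z" for z
  proof -
    have "x / p + y / q + w / r = (x + y + w) / p + (y * (1 / q - 1 / p) + w * (1 / r - 1 / p))"
      for x y w p q r :: complex
      by (simp add: right_diff_distrib add_divide_distrib)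
    then show ?thesis
      unfolding c_def d_def m[symmetric] sum_three[of _ k] .
  qed
  have log1: "(arc_log k has_field_derivative 1 / (z - a (k + 1)) - 1 / (z - a k)) (at z)"
    if "z \<notin> closed_subarc g t k" for z
    using arc_log_derivative[OF that] .
  have log2: "(arc_log (k + 1) has_field_derivative 1 / (z - a (k - 1)) - 1 / (z - a (k + 1))) (at z)"
    if "z \<notin> closed_subarc g t (k + 1)" for z
    using arc_log_derivative[OF that] by (simp only: shift)
  have log3: "(arc_log (k - 1) has_field_derivative 1 / (z - a k) - 1 / (z - a (k - 1))) (at z)"
    if "z \<notin> closed_subarc g t (k - 1)" for z
    using arc_log_derivative[OF that] by (simp only: shift)
  have F1: "(F1 has_field_derivative d z) (at z)" if "z \<notin> K1" for z
  proof -
    have "(F1 has_field_derivative e (k + 1) * (1 / (z - a (k + 1)) - 1 / (z - a k))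
        + e (k - 1) * ((1 / (z - a (k + 1)) - 1 / (z - a k)) + (1 / (z - a (k - 1)) - 1 / (z - a (k + 1))))) (at z)"
      unfolding F1_def by (intro DERIV_add DERIV_cmult log1 log2) (use that in \<open>auto simp: K1_def\<close>)
    then show ?thesis by (simp add: d_def)
  qed
  have F2: "(F2 has_field_derivative d z) (at z)" if "z \<notin> K2" for z
  proof -
    have "(F2 has_field_derivative - e (k - 1) * (1 / (z - a k) - 1 / (z - a (k - 1)))
        - e (k + 1) * ((1 / (z - a (k - 1)) - 1 / (z - a (k + 1))) + (1 / (z - a k) - 1 / (z - a (k - 1))))) (at z)"
      unfolding F2_def by (intro DERIV_add DERIV_diff DERIV_cmult log2 log3) (use that in \<open>auto simp: K2_def\<close>)
    moreover have "- e (k - 1) * (1 / (z - a k) - 1 / (z - a (k - 1)))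
        - e (k + 1) * ((1 / (z - a (k - 1)) - 1 / (z - a (k + 1))) + (1 / (z - a k) - 1 / (z - a (k - 1)))) = d z"
    proof -
      have "- w * (1 / p - 1 / r) - y * ((1 / r - 1 / q) + (1 / p - 1 / r)) = y * (1 / q - 1 / p) + w * (1 / r - 1 / p)"
        for y w p q r :: complex
        by (simp add: right_diff_distrib)
      then show ?thesis unfolding d_def .
    qed
    ultimately show ?thesis by simp
  qed
  have G1: "(G F1 has_field_derivative c z * G F1 z) (at z)" if "z \<notin> K1" "z \<notin> range a" for z
    unfolding G_def cd by (rule power_exp_derivative[OF F1[OF that(1)]]) (use that(2) in auto)
  have G2: "(G F2 has_field_derivative c z * G F2 z) (at z)" if "z \<notin> K2" "z \<notin> range a" for z
    unfolding G_def cd by (rule power_exp_derivative[OF F2[OF that(1)]]) (use that(2) in auto)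
  have Gnz: "G F z \<noteq> 0" if "z \<notin> range a" for F z
    using that by (auto simp: G_def)
  have der': "((\<lambda>z. \<psi> (q z)) has_field_derivative c z * \<psi> (q z)) (at z)" if "chart X \<rho> V N D q" "z \<in> D" for V N D q z
    unfolding c_def by (rule der[OF that])
  have K: "compact K1" "compact K2"
    unfolding K1_def K2_def by (intro compact_Un compact_closed_subarc)+
  have F12: "F1 z - F2 z = (e (k + 1) + e (k - 1)) * (2 * of_real pi * \<i> * winding_number g z)"
    if "z \<notin> path_image g" for z
  proof -
    have "arc_log k z + arc_log (k + 1) z + arc_log (k - 1) z = (\<Sum>j\<in>UNIV. arc_log j z)"
      by (rule sum_three[symmetric])
    also have "\<dots> = 2 * of_real pi * \<i> * winding_number g z"
      unfolding sum_3 by (rule arc_log_sum[OF that])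
    finally have sum: "arc_log k z + arc_log (k + 1) z + arc_log (k - 1) z = 2 * of_real pi * \<i> * winding_number g z" .
    have "u * x + v * (x + y) - (- v * w - u * (y + w)) = (u + v) * (x + y + w)" for u v w x y :: complex
      by (simp add: distrib_left distrib_right)
    then show ?thesis
      unfolding F1_def F2_def sum[symmetric] .
  qed
  obtain s1 s2 where p: "arc p" "path_image p \<subseteq> X" "\<rho> (pathfinish p) = \<rho> (pathstart p)" and s12: "s1 < s2"
    and meet: "{s \<in> {0..1}. \<rho> (p s) \<in> Fin ` path_image g} = {s1, s2}"
    and P1: "\<rho> (p s1) \<in> Fin ` subarc g t (k - 1)" and P2: "\<rho> (p s2) \<in> Fin ` subarc g t k"
    and out: "\<And>s. s \<in> {s1<..<s2} \<Longrightarrow> \<rho> (p s) \<notin> Fin ` inside (path_image g)"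
    using loop unfolding loop_around_def by blast
  have s01: "s1 \<in> {0..1}" "s2 \<in> {0..1}" using meet by blast+
  have contp: "continuous_on {0..1} p" and pX: "\<And>s. s \<in> {0..1} \<Longrightarrow> p s \<in> X"
    using p(1,2) unfolding arc_def path_def path_image_def by auto
  have contr: "continuous_on {0..1} (\<lambda>s. \<rho> (p s))"
    by (rule continuous_on_compose2[OF _ contp]) (use cov pX in \<open>auto simp: covering_space_def\<close>)
  \<comment> \<open>The loop may pass through infinity between the crossings. Just after
    \<open>s1\<close> it is still finite by continuity.\<close>
  obtain s where s: "s1 < s" "s < s2" "\<rho> (p s) \<noteq> Infty"
  proof -
    have "open (- {Infty})"
      by (auto simp: open_riemann_sphere_def vimage_def)
    then have "openin (top_of_set {0..1}) ({0..1} \<inter> (\<lambda>s. \<rho> (p s)) -` (- {Infty}))"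
      by (rule continuous_openin_preimage_gen[OF contr])
    moreover have "s1 \<in> {0..1} \<inter> (\<lambda>s. \<rho> (p s)) -` (- {Infty})"
      using s01 P1 by auto
    ultimately obtain r where r: "r > 0" "ball s1 r \<inter> {0..1} \<subseteq> {0..1} \<inter> (\<lambda>s. \<rho> (p s)) -` (- {Infty})"
      unfolding openin_contains_ball by blast
    define s where "s = min ((s1 + s2) / 2) (s1 + r / 2)"
    have s: "s1 < s" "s < s2" "s - s1 < r"
      using r(1) s12 by (auto simp: s_def min_def field_simps)
    then have "s \<in> ball s1 r \<inter> {0..1}"
      using s01 by (auto simp: dist_real_def)
    then have "\<rho> (p s) \<noteq> Infty" using r(2) by blast
    then show ?thesis using that s by blast
  qed
  define w0 where "w0 = fin_part (\<rho> (pathstart p))"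
  define ws where "ws = fin_part (\<rho> (p s))"
  have w0: "\<rho> (p 0) = Fin w0" "\<rho> (p 1) = Fin w0" "w0 \<in> inside (path_image g)"
    using start p(3) by (auto simp: w0_def pathstart_def pathfinish_def)
  have ws: "\<rho> (p s) = Fin ws"
    using s(3) by (cases "\<rho> (p s)") (auto simp: ws_def)
  have s_in: "s \<in> {0..1}" using s s01 by auto
  have finp: "p 0 \<in> X" "p s \<in> X" "p 1 \<in> X" using pX s_in by auto
  have on_curve: "r \<in> {s1, s2}" if "r \<in> {0..1}" "\<rho> (p r) \<in> Fin ` path_image g" for r
    using that meet by blast
  \<comment> \<open>Up to time \<open>s\<close> the curve is met at \<open>s1\<close> only, on the
    open arc \<open>k - 1\<close>, which is disjoint from both arcs of \<open>K1\<close>.\<close>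
  have avoid1: "\<rho> x \<notin> Fin ` K1" if x: "x \<in> p ` {0..s}" for x
  proof
    assume x': "\<rho> x \<in> Fin ` K1"
    obtain r where r: "r \<in> {0..s}" "x = p r" using x by auto
    have "K1 \<subseteq> path_image g" unfolding K1_def using closed_subarc_subset by blast
    then have "r \<in> {s1, s2}" using on_curve[of r] r x' s_in by auto
    then have "r = s1" using r(1) s by auto
    then show False
      using x' r P1 subarc_disjoint[OF shift(1)] subarc_disjoint[OF shift(3)] unfolding K1_def by auto
  qed
  have avoid2: "\<rho> x \<notin> Fin ` K2" if x: "x \<in> p ` {s..1}" for x
  proof
    assume x': "\<rho> x \<in> Fin ` K2"
    obtain r where r: "r \<in> {s..1}" "x = p r" using x by auto
    have "K2 \<subseteq> path_image g" unfolding K2_def using closed_subarc_subset by blast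
    then have "r \<in> {s1, s2}" using on_curve[of r] r x' s_in by auto
    then have "r = s2" using r(1) s by auto
    then show False
      using x' r P2 subarc_disjoint[OF shift(1)[symmetric]] subarc_disjoint[OF shift(2)[symmetric]]
      unfolding K2_def by auto
  qed
  have part1: "\<psi> (p 0) / G F1 w0 = \<psi> (p s) / G F1 ws"
  proof -
    have "\<psi> (p 0) / G F1 (fin_part (\<rho> (p 0))) = \<psi> (p s) / G F1 (fin_part (\<rho> (p s)))"
    proof (rule multiplier_along[OF cov _ _ K(1) avoid1 der' G1 Gnz])
      show "connected (p ` {0..s})"
        using s_in by (intro connected_continuous_image continuous_on_subset[OF contp]) auto
      show "p ` {0..s} \<subseteq> X" using pX s_in by auto
    qed (use w0 ws s_in in auto)
    then show ?thesis by (simp add: w0 ws)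
  qed
  have part2: "\<psi> (p s) / G F2 ws = \<psi> (p 1) / G F2 w0"
  proof -
    have "\<psi> (p s) / G F2 (fin_part (\<rho> (p s))) = \<psi> (p 1) / G F2 (fin_part (\<rho> (p 1)))"
    proof (rule multiplier_along[OF cov _ _ K(2) avoid2 der' G2 Gnz])
      show "connected (p ` {s..1})"
        using s_in by (intro connected_continuous_image continuous_on_subset[OF contp]) auto
      show "p ` {s..1} \<subseteq> X" using pX s_in by auto
    qed (use w0 ws s_in in auto)
    then show ?thesis by (simp add: w0 ws)
  qed
  have off_a: "z \<notin> range a" if "x \<in> X" "\<rho> x = Fin z" for x z
    using that cov unfolding covering_space_def by blast
  have w0_off: "w0 \<notin> path_image g"
    using w0(3) inside_no_overlap[of "path_image g"] by blast
  have ws_off: "ws \<notin> path_image g"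
    using on_curve[OF s_in] s ws by auto
  have ws_out: "ws \<notin> inside (path_image g)"
    using out[of s] s ws by auto
  \<comment> \<open>At the intermediate point the winding number is 0, so the two formulas can be
    glued there.\<close>
  have "F1 ws = F2 ws"
    using F12[OF ws_off] winding_number_outside[OF ws_out ws_off] by simp
  then have "G F1 ws = G F2 ws" by (simp add: G_def)
  then have eq: "\<psi> (p 0) / G F1 w0 = \<psi> (p 1) / G F2 w0"
    using part1 part2 by simp
  have "F1 w0 - F2 w0 = (e (k + 1) + e (k - 1)) * (2 * of_real pi * \<i>)"
    using F12[OF w0_off] winding_number_inside[OF w0(3)] by simp
  moreover have "e (k + 1) + e (k - 1) = of_int m - e k"
    unfolding m[symmetric] sum_three[of _ k] by simp
  moreover have "y = x + 2 * of_real pi * \<i> * e k - 2 * of_int m * of_real pi * \<i>"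
    if "x - y = u * (2 * of_real pi * \<i>)" "u = of_int m - e k" for x y u
  proof -
    have "y = x - u * (2 * of_real pi * \<i>)" using that(1) by (simp add: algebra_simps)
    then show ?thesis unfolding that(2) by (simp add: algebra_simps)
  qed
  ultimately have F2w0: "F2 w0 = F1 w0 + 2 * of_real pi * \<i> * e k - 2 * of_int m * of_real pi * \<i>"
    by blast
  \<comment> \<open>Since \<open>m\<close> is an integer, its contribution to the exponent is a
    period of \<open>exp\<close>; only \<open>e k\<close> survives.\<close>
  have "exp (F2 w0) = exp (F1 w0) * exp (2 * of_real pi * \<i> * e k)"
  proof -
    have "exp (2 * of_int m * of_real pi * \<i>) = (1::complex)"
      using exp_integer_2pi[of "of_int m"] by (simp add: mult_ac)
    with F2w0 show ?thesis
      by (simp only: exp_diff exp_add div_by_1)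
  qed
  then have "G F2 w0 = G F1 w0 * exp (2 * of_real pi * \<i> * e k)"
    by (simp add: G_def)
  moreover have "G F1 w0 \<noteq> 0" "G F2 w0 \<noteq> 0"
    using Gnz off_a[OF finp(1) w0(1)] by auto
  ultimately have "\<psi> (p 1) = exp (2 * of_real pi * \<i> * e k) * \<psi> (p 0)"
    using eq by (simp add: divide_simps mult_ac)
  then show ?thesis by (simp add: pathstart_def pathfinish_def)
qed

end


section \<open>The indices\<close>

text \<open>For triangular \<open>A\<close> the second component solves a scalar equation in every
  chart, so its vanishing is locally constant. \<open>constant_off_infinity\<close> is applied to
  this truth value.\<close>

lemma lower_row_zero:
  fixes Y :: "'b::topological_space \<Rightarrow> complex^2^2" and A :: "complex \<Rightarrow> complex^2^2"
  assumes cov: "covering_space X \<rho> (- Fin ` range (a :: 3 \<Rightarrow> complex))" and conn: "connected X"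
    and sol: "solution (X - \<rho> -` {Infty}) (\<lambda>x. fin_part (\<rho> x)) A Y"
    and holo: "(\<lambda>z. A z $ 2 $ 2) holomorphic_on (- range a)"
    and tri: "\<And>z. z \<notin> range a \<Longrightarrow> A z $ 2 $ 1 = 0"
    and x: "x \<in> X - \<rho> -` {Infty}" "(Y x *v v) $ 2 = 0" and y: "y \<in> X - \<rho> -` {Infty}"
  shows "(Y y *v v) $ 2 = 0"
proof -
  have S: "open (- Fin ` range a)"
    by (intro open_Compl_Fin_image finite_imp_compact) simp
  have "((Y x *v v) $ 2 = 0) = ((Y y *v v) $ 2 = 0)"
  proof (rule constant_off_infinity[OF cov S conn subset_refl])
    fix w assume "w \<in> X"
    show "\<exists>V. open V \<and> \<rho> w \<in> V \<and> (\<forall>N D q. chart X \<rho> V N D q \<longrightarrow>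
        (\<lambda>z. (Y (q z) *v v) $ 2 = 0) constant_on D)"
    proof (intro exI[of _ UNIV] conjI allI impI)
      fix N D q assume ch: "chart X \<rho> UNIV N D q"
      note Da = chart_domain[OF cov ch]
      have D: "open D" "connected D" using ch unfolding chart_def by blast+
      show "(\<lambda>z. (Y (q z) *v v) $ 2 = 0) constant_on D"
      proof (rule linear_ode_zero_constant[OF D])
        show "(\<lambda>z. A z $ 2 $ 2) holomorphic_on D"
          by (rule holomorphic_on_subset[OF holo]) (use Da in blast)
        fix z assume z: "z \<in> D"
        show "((\<lambda>z. (Y (q z) *v v) $ 2) has_field_derivative A z $ 2 $ 2 * (Y (q z) *v v) $ 2) (at z)"
          using chart_solution_derivative[OF sol ch z, of v 2]
          unfolding mult_vec_2[of "A z"] tri[OF Da[OF z]] by simp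
      qed
    qed auto
  qed (use x(1) y in auto)
  then show ?thesis using x(2) by simp
qed

theorem corollary6p4:
  fixes M E :: "3 \<Rightarrow> complex^2^2"
    and a :: "3 \<Rightarrow> complex"
    and g :: "real \<Rightarrow> complex" and t :: "3 \<Rightarrow> real"
    and X :: "'b::topological_space set" and \<rho> :: "'b \<Rightarrow> riemann_sphere"
    and z0 :: 'b and \<sigma> :: "3 \<Rightarrow> 'b \<Rightarrow> 'b"
    and A :: "complex \<Rightarrow> complex^2^2"
    and \<kappa>' :: int and \<kappa> :: "2 \<Rightarrow> int"
  assumes "curve_through g t a"
    and "universal_covering X \<rho> (- Fin ` range a)"
    and "basic_deck_transformations X \<rho> g t z0 \<sigma>"
    and "admissible_data M E"
    and "standard_form X \<rho> \<sigma> a M E \<kappa> A"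
    and "of_int \<kappa>' = (\<Sum>k\<in>UNIV. trace (E k))"
    and "irreducible_tuple M \<or>
         ((\<exists>!U. nontrivial_invariant_subspace M U) \<and> (\<exists>n. exponent_sums M E n \<and> n 1 < n 2))"
  shows "(odd \<kappa>' \<longrightarrow> \<kappa> 1 = (\<kappa>' + 1) div 2 \<and> \<kappa> 2 = (\<kappa>' - 1) div 2) \<and>
         (even \<kappa>' \<longrightarrow> \<kappa> 1 = \<kappa>' div 2 \<and> \<kappa> 2 = \<kappa>' div 2)"
proof -
  interpret curve g t a by unfold_locales (rule assms(1))
  have cov: "covering_space X \<rho> (- Fin ` range a)" and conn: "connected X"
    using assms(2) simply_connected_connected unfolding universal_covering_def by blast+
  have \<kappa>_ge: "\<kappa> 1 \<ge> \<kappa> 2"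
    and holo: "\<And>i j. (\<lambda>z. A z $ i $ j) holomorphic_on (- range a)"
    and mono: "monodromy X \<rho> \<sigma> A = similarity_class M"
    and loc: "\<And>k. local_form_at (a k) (E k) A"
    and inf: "local_form_infinity \<kappa> A"
    using assms(5) unfolding standard_form_def by blast+
  have three: "CARD(3) \<le> 3" by simp
  obtain P where P: "\<And>k. invertible (P k)"
    and \<kappa>: "\<And>i. of_int (\<kappa> i) = (\<Sum>k\<in>UNIV. (P k ** E k ** inv2 (P k)) $ i $ i)"
    and diag: "\<And>i z. z \<notin> range a \<Longrightarrow> A z $ i $ i = (\<Sum>k\<in>UNIV. (P k ** E k ** inv2 (P k)) $ i $ i / (z - a k))"
    and A21: "\<And>z. \<kappa> 1 - \<kappa> 2 \<ge> 2 \<Longrightarrow> z \<notin> range a \<Longrightarrow> A z $ 2 $ 1 = 0"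
    and R21: "\<And>k. \<kappa> 1 - \<kappa> 2 \<ge> 2 \<Longrightarrow> (P k ** E k ** inv2 (P k)) $ 2 $ 1 = 0"
    by (rule system_residues[OF inj_a three holo loc inf]) (rule that)
  define e where "e k = (P k ** E k ** inv2 (P k)) $ 1 $ 1" for k
  \<comment> \<open>Each residue is conjugate to \<open>E k\<close> and so has the same
    trace.\<close>
  have "(of_int (\<kappa> 1) + of_int (\<kappa> 2) :: complex) = (\<Sum>k\<in>UNIV. trace (P k ** E k ** inv2 (P k)))"
    unfolding \<kappa> by (simp add: trace_def sum_2 sum.distrib)
  also have "\<dots> = of_int \<kappa>'"
    unfolding similar_residue(1)[OF P] assms(6) ..
  finally have "of_int (\<kappa> 1 + \<kappa> 2) = (of_int \<kappa>' :: complex)" by simp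
  then have sum: "\<kappa> 1 + \<kappa> 2 = \<kappa>'" by (simp only: of_int_eq_iff)
  have small: "\<kappa> 1 - \<kappa> 2 < 2"
  proof (rule ccontr)
    assume "\<not> \<kappa> 1 - \<kappa> 2 < 2"
    then have big: "\<kappa> 1 - \<kappa> 2 \<ge> 2" by simp
    let ?X = "X - \<rho> -` {Infty}"
    \<comment> \<open>\<open>M\<close> belongs to its own similarity class, so some solution has
      exactly the matrices \<open>M k\<close> as its monodromy.\<close>
    obtain Y where sol: "solution ?X (\<lambda>x. fin_part (\<rho> x)) A Y"
      and Y: "\<And>k x. x \<in> ?X \<Longrightarrow> Y x = Y (\<sigma> k x) ** M k"
      using mem_similarity_class[of M] unfolding mono[symmetric] monodromy_def by blast
    have z0X: "z0 \<in> X" and z0in: "\<rho> z0 \<in> Fin ` inside (path_image g)"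
      and deck: "\<And>k. deck_transformation X \<rho> (\<sigma> k)"
      and loops: "\<And>k. \<exists>p. loop_around X \<rho> g t k p \<and> pathstart p = z0 \<and> pathfinish p = \<sigma> k z0"
      using assms(3) unfolding basic_deck_transformations_def by blast+
    have z0: "z0 \<in> ?X" using z0X z0in by auto
    have \<sigma>z0: "\<sigma> k z0 \<in> ?X" for k
    proof -
      have "\<sigma> k z0 \<in> X" "\<rho> (\<sigma> k z0) = \<rho> z0"
        using deck[of k] z0X unfolding deck_transformation_def homeomorphism_def by blast+
      then show ?thesis using z0 by auto
    qed
    have Yz0: "invertible (Y z0)" using sol z0 unfolding solution_def by blast
    have row: "(Y y *v v) $ 2 = 0" if "x \<in> ?X" "(Y x *v v) $ 2 = 0" "y \<in> ?X" for x y v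
      by (rule lower_row_zero[OF cov conn sol holo _ that]) (rule A21[OF big])
    have Yv: "Y z0 *v v = Y (\<sigma> k z0) *v (M k *v v)" for k v
      unfolding matrix_vector_mul_assoc Y[OF z0, of k, symmetric] ..
    \<comment> \<open>By \<open>row\<close>, vanishing of the second component may be tested at any
      finite point of the covering, in particular at \<open>\<sigma> k z0\<close>; this makes
      \<open>U\<close> invariant.\<close>
    define U where "U = {v. (Y z0 *v v) $ 2 = 0}"
    have U: "nontrivial_invariant_subspace M U"
      unfolding nontrivial_invariant_subspace_def
    proof (intro conjI allI ballI)
      show "vec.subspace U" unfolding U_def by (rule kernel_row_subspace)
      show "U \<noteq> {0}" "U \<noteq> UNIV" unfolding U_def by (rule kernel_row_nontrivial[OF Yz0])+
      fix k v assume "v \<in> U"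
      then have "(Y z0 *v v) $ 2 = 0" by (simp add: U_def)
      then have "(Y (\<sigma> k z0) *v (M k *v v)) $ 2 = 0"
        unfolding Yv[of v k] .
      from row[OF \<sigma>z0 this z0] show "M k *v v \<in> U"
        unfolding U_def by simp
    qed
    then have "\<not> irreducible_tuple M"
      unfolding irreducible_tuple_def by blast
    then have unique: "\<exists>!U. nontrivial_invariant_subspace M U"
      and "\<exists>n. exponent_sums M E n \<and> n 1 < n 2"
      using assms(7) by blast+
    then obtain n where n: "exponent_sums M E n" "n 1 < n 2" by blast
    obtain N \<epsilon> where N: "N \<in> similarity_class M" and N21: "\<And>k. N k $ 2 $ 1 = 0"
      and eps: "\<And>k. eigenvalues (E k) = {\<epsilon> k 1, \<epsilon> k 2}"
      and N_eps: "\<And>k j. N k $ j $ j = exp (- 2 * of_real pi * \<i> * \<epsilon> k j)"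
      and n_eps: "\<And>j. of_int (n j) = (\<Sum>k\<in>UNIV. \<epsilon> k j)"
      using n(1) unfolding exponent_sums_def by blast
    obtain C where C: "invertible C" "\<And>k. N k = matrix_inv C ** M k ** C"
      using N unfolding similarity_class_def by blast
    \<comment> \<open>The first column of the triangularizing matrix is a common eigenvector of all
      \<open>M k\<close>. By uniqueness it spans \<open>U\<close>.\<close>
    define v where "v = C *v axis 1 1"
    have v0: "v \<noteq> 0"
      unfolding v_def by (rule invertible_mult_nonzero[OF C(1)]) (simp add: axis_eq_0_iff)
    have Mv: "M k *v v = N k $ 1 $ 1 *s v" for k
    proof -
      have "C ** N k = M k ** C"
        unfolding C(2) by (simp add: matrix_mul_assoc matrix_inv_right_left[OF C(1)])
      then have "M k *v v = C *v (N k *v axis 1 1)"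
        unfolding v_def matrix_vector_mul_assoc by simp
      also have "N k *v axis 1 1 = N k $ 1 $ 1 *s axis 1 1"
        unfolding vec_2_eq_iff mult_vec_2 by (simp add: N21 axis_def)
      finally show ?thesis unfolding vec.scale v_def .
    qed
    have "vec.span {v} = U"
      using unique U eigenline_invariant[of v M "\<lambda>k. N k $ 1 $ 1", OF v0 Mv] by blast
    then have vU: "(Y z0 *v v) $ 2 = 0"
      using vec.span_base[of v "{v}"] unfolding U_def by blast
    define \<psi> where "\<psi> x = (Y x *v v) $ 1" for x
    have \<psi>0: "\<psi> z0 \<noteq> 0"
      using invertible_mult_nonzero[OF Yz0 v0] vU unfolding vec_2_eq_iff \<psi>_def by simp
    have mult: "\<psi> z0 = N k $ 1 $ 1 * \<psi> (\<sigma> k z0)" for k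
      unfolding \<psi>_def Yv[of v k] Mv vec.scale by simp
    \<comment> \<open>The second component of \<open>Y v\<close> vanishes throughout, so only entry
      1 1 of \<open>A\<close> acts on the first one.\<close>
    have der: "((\<lambda>z. \<psi> (q z)) has_field_derivative (\<Sum>j\<in>UNIV. e j / (z - a j)) * \<psi> (q z)) (at z)"
      if ch: "chart X \<rho> V N' D q" and z: "z \<in> D" for V N' D q z
    proof -
      have "q z \<in> ?X"
        using ch z openin_imp_subset unfolding chart_def by fastforce
      then have "(Y (q z) *v v) $ 2 = 0" by (rule row[OF z0 vU])
      then show ?thesis
        using chart_solution_derivative[OF sol ch z, of v 1]
        unfolding mult_vec_2[of "A z"] \<psi>_def e_def diag[OF chart_domain[OF cov ch z]] by simp
    qed
    have m: "(\<Sum>j\<in>UNIV. e j) = of_int (\<kappa> 1)"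
      unfolding e_def \<kappa> ..
    have e_eps: "e k = \<epsilon> k 1" for k
    proof -
      obtain p where p: "loop_around X \<rho> g t k p" "pathstart p = z0" "pathfinish p = \<sigma> k z0"
        using loops by blast
      have "\<psi> (pathfinish p) = exp (2 * of_real pi * \<i> * e k) * \<psi> (pathstart p)"
        by (rule loop_multiplier[OF cov p(1) _ m]) (use z0in p(2) in simp, rule der)
      then have "\<psi> z0 = N k $ 1 $ 1 * (exp (2 * of_real pi * \<i> * e k) * \<psi> z0)"
        using mult[of k] p(2,3) by simp
      \<comment> \<open>The eigenvalue is the inverse of the multiplier because the monodromy matrix
        stands on the side of \<open>\<sigma> k x\<close> in
        \<open>Y x = Y (\<sigma> k x) ** M k\<close>.\<close>
      then have "N k $ 1 $ 1 * exp (2 * of_real pi * \<i> * e k) = 1"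
        using \<psi>0 by simp
      then have "exp (2 * of_real pi * \<i> * e k) = exp (2 * of_real pi * \<i> * \<epsilon> k 1)"
        unfolding N_eps by (simp add: exp_minus field_simps)
      then obtain d :: int where "2 * of_real pi * \<i> * e k = 2 * of_real pi * \<i> * \<epsilon> k 1 + of_real (of_int (2 * d) * pi) * \<i>"
        unfolding exp_eq by auto
      then have "2 * of_real pi * \<i> * (e k - \<epsilon> k 1) = 2 * of_real pi * \<i> * of_int d"
        by (simp add: algebra_simps)
      then have d: "e k - \<epsilon> k 1 = of_int d"
        by simp
      \<comment> \<open>So far \<open>e k\<close> and \<open>\<epsilon> k 1\<close> agree modulo
        integers; being eigenvalues of the same non-resonant matrix, they coincide.\<close>
      have "e k \<in> eigenvalues (E k)"
        unfolding e_def by (rule similar_residue(2)[OF P R21[OF big]])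
      moreover have "\<epsilon> k 1 \<in> eigenvalues (E k)" unfolding eps by simp
      moreover have "non_resonant (E k)"
        using assms(4) unfolding admissible_data_def by blast
      ultimately have "d = 0"
        using d unfolding non_resonant_def by blast
      then show ?thesis using d by simp
    qed
    have "of_int (n 1) = (of_int (\<kappa> 1) :: complex)"
      unfolding n_eps m[symmetric] e_eps ..
    then have n1: "n 1 = \<kappa> 1" by (simp only: of_int_eq_iff)
    have "of_int (n 1 + n 2) = (\<Sum>k\<in>UNIV. \<epsilon> k 1 + \<epsilon> k 2)"
      by (simp add: n_eps sum.distrib)
    also have "\<dots> = of_int \<kappa>'"
      unfolding assms(6) trace_eq_sum_eigenvalues[OF eps] ..
    finally have "n 1 + n 2 = \<kappa>'" by (simp only: of_int_eq_iff)
    \<comment> \<open>With \<open>n 1 = \<kappa> 1\<close> and equal sums,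
      \<open>n 2 = \<kappa> 2 \<le> \<kappa> 1 = n 1\<close>, against
      \<open>n 1 < n 2\<close>.\<close>
    then show False
      using n(2) n1 sum \<kappa>_ge by linarith
  qed
  from small \<kappa>_ge have "\<kappa> 1 = \<kappa> 2 \<or> \<kappa> 1 = \<kappa> 2 + 1" by linarith
  then show ?thesis
    unfolding sum[symmetric] by auto
qed

end
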